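(* Let $p$ be a prime and let $F\subseteq\mathbb{Z}^2$ be an exact cluster of full affine span with $|F|=p^2$. Then for every $F$-tiling $T$, the orbit closure $\overline{\mathbb{Z}^2\cdot T}$ contains a $1$-periodic $F$-tiling.
   Context: A cluster is a finite subset of $\mathbb{Z}^2$. An $F$-tiling is a subset $T\subseteq\mathbb{Z}^2$ such that every element of $\mathbb{Z}^2$ has a unique representation $a+t$ with $a\in F$, $t\in T$; $F$ is exact if an $F$-tiling exists. $F$ has full affine span if $F-F=\{a-b:a,b\in F\}$ generates $\mathbb{Z}^2$ as a group. A subset $T\subseteq\mathbb{Z}^2$ is identified with its indicator $1_T\in\{0,1\}^{\mathbb{Z}^2}$ (product topology). $\mathbb{Z}^2$ acts by $(v\cdot c)(x)=c(x-v)$, and $\overline{\mathbb{Z}^2\cdot T}$ is the closure of $\{v\cdot 1_T:v\in\mathbb{Z}^2\}$. $T$ is $1$-periodic if there is a nonzero $v\in\mathbb{Z}^2$ with $T+v=T$. *)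

theory Defs
  imports
    "HOL-Analysis.Function_Topology"
    "HOL-Computational_Algebra.Primes"
    "HOL-Computational_Algebra.Group_Closure"
begin

definition tiling :: "(int \<times> int) set \<Rightarrow> (int \<times> int) set \<Rightarrow> bool" where
  "tiling F T \<longleftrightarrow> (\<forall>x. \<exists>!(a, t). a \<in> F \<and> t \<in> T \<and> a + t = x)"

definition exact :: "(int \<times> int) set \<Rightarrow> bool" where
  "exact F \<longleftrightarrow> (\<exists>T. tiling F T)"

definition full_affine_span :: "(int \<times> int) set \<Rightarrow> bool" where
  "full_affine_span F \<longleftrightarrow> group_closure {a - b | a b. a \<in> F \<and> b \<in> F} = UNIV"

definition one_periodic :: "(int \<times> int) set \<Rightarrow> bool" where
  "one_periodic T \<longleftrightarrow> (\<exists>v. v \<noteq> 0 \<and> (\<lambda>t. t + v) ` T = T)"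

definition shift :: "int \<times> int \<Rightarrow> (int \<times> int \<Rightarrow> nat) \<Rightarrow> (int \<times> int \<Rightarrow> nat)" where
  "shift v c = (\<lambda>x. c (x - v))"

definition config_space :: "(int \<times> int \<Rightarrow> nat) topology" where
  "config_space = product_topology (\<lambda>_. discrete_topology {0, 1}) UNIV"

definition orbit_closure :: "(int \<times> int) set \<Rightarrow> (int \<times> int \<Rightarrow> nat) set" where
  "orbit_closure T = config_space closure_of (range (\<lambda>v. shift v (indicator T)))"

end

theory Submission
  imports
    Defs
    "HOL-Library.Poly_Mapping"
    "HOL-Computational_Algebra.Polynomial"
begin

text \<open>
  The tiling \<open>T\<close> itself turns out to be 1-periodic, so that it serves as the required point of
  its orbit closure. The argument is algebraic: let the ring of Laurent polynomials act on functions
  on the lattice, and translate \<open>F\<close> so that it contains the origin. The indicator function \<open>g\<close>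
  of \<open>T\<close> satisfies \<open>act (mask_poly F 1) g = 1\<close>.

  By Frobenius, the same equation holds for the dilates of \<open>F\<close> by all \<open>r\<close> prime to \<open>p\<close>
  (\<open>dilated_tiling\<close>). The exponents \<open>1 + p j\<close> give a Vandermonde system, whose solution says that
  \<open>g\<close> is annihilated by the product of the differences \<open>1 - X (scale_vec p a)\<close> with
  \<open>a \<in> F - {0}\<close> (\<open>product_of_differences_annihilates\<close>).

  This product is then shortened. Parallel factors merge, as a bounded function annihilated by a
  square \<open>(1 - X w)\<^sup>2\<close> is annihilated by \<open>1 - X w\<close>. Suppose some line in the direction of a factor
  \<open>1 - X u\<close> meets \<open>F\<close> in a number of points not divisible by \<open>p\<close>, and let \<open>h\<close> be the result
  of applying the other factors to \<open>g\<close>. Then \<open>h\<close> is \<open>u\<close>-periodic, and modulo \<open>p\<close> the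
  dilated tiling equations give a linear recurrence for \<open>h\<close> in any other direction \<open>v\<close>, with
  the line counts as coefficients. So \<open>h\<close> has a period along \<open>v\<close> modulo \<open>p\<close>, hence modulo
  every power of \<open>p\<close>, hence exactly since it is bounded
  (\<open>bounded_dilation_kernel_periodic\<close>). If \<open>1 - X v\<close> is one of the other factors, this trades the
  factor of \<open>u\<close> for a second one in direction \<open>v\<close>, and the two merge. In the end either a single
  factor is left and \<open>T\<close> is 1-periodic, or there are two non-parallel directions in which all
  line counts of \<open>F\<close> are divisible by \<open>p\<close> (\<open>periodic_or_two_divisible_directions\<close>).

  In the second case \<open>card F = p\<^sup>2\<close> leaves only one possibility: \<open>F\<close> is the sum of two
  \<open>p\<close>-element sets on lines in the two directions (\<open>product_of_axes\<close>). Tiles of prime size force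
  periods (\<open>prime_tile_period\<close>), and since \<open>F\<close> spans the lattice, the primitive vectors \<open>\<alpha>\<close>,
  \<open>\<beta>\<close> of the two lines form a basis and the two sets are complete residue systems modulo \<open>p\<close>. So
  \<open>T\<close> behaves like a tiling by squares of side \<open>p\<close>, which consists of columns or of rows: it has
  period \<open>p \<alpha>\<close> or \<open>p \<beta>\<close> (\<open>product_tiling_periodic\<close>).
\<close>

section \<open>Laurent polynomials acting on configurations\<close>

type_synonym vec = "int \<times> int"

type_synonym laurent = "vec \<Rightarrow>\<^sub>0 int"

abbreviation X :: "vec \<Rightarrow> laurent" where
  "X a \<equiv> Poly_Mapping.single a 1"

text \<open>Convolution with the coefficients of \<open>P\<close>. It makes the integer-valued functions on the
  lattice a module over the Laurent polynomials: the monomial \<open>X a\<close> acts as the translation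
  by \<open>a\<close>, and a periodicity or a tiling equation for \<open>h\<close> becomes a statement on a single
  polynomial.\<close>

definition act :: "laurent \<Rightarrow> (vec \<Rightarrow> int) \<Rightarrow> vec \<Rightarrow> int" where
  "act P h x = (\<Sum>a\<in>Poly_Mapping.keys P. Poly_Mapping.lookup P a * h (x - a))"

definition scale_vec :: "int \<Rightarrow> vec \<Rightarrow> vec" where
  "scale_vec k a = (k * fst a, k * snd a)"

definition bounded_config :: "(vec \<Rightarrow> int) \<Rightarrow> bool" where
  "bounded_config h \<longleftrightarrow> (\<exists>C. \<forall>x. \<bar>h x\<bar> \<le> C)"

text \<open>Vectors are handled through their group structure; splitting them into coordinates only
  hides it.\<close>

declare split_paired_All [simp del] split_paired_Ex [simp del]

lemma act_superset:
  assumes "finite A" "Poly_Mapping.keys P \<subseteq> A"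
  shows "act P h x = (\<Sum>a\<in>A. Poly_Mapping.lookup P a * h (x - a))"
  unfolding act_def using assms
  by (intro sum.mono_neutral_left) (auto simp: in_keys_iff)

lemma act_zero_left [simp]: "act 0 h = (\<lambda>x. 0)"
  by (simp add: act_def fun_eq_iff)

lemma act_X [simp]: "act (X a) h = (\<lambda>x. h (x - a))"
  by (simp add: act_def fun_eq_iff)

lemma act_one [simp]: "act 1 h = h"
  using act_X [of 0 h] by simp

lemma act_add: "act (P + Q) h = (\<lambda>x. act P h x + act Q h x)"
proof
  fix x
  let ?A = "Poly_Mapping.keys P \<union> Poly_Mapping.keys Q"
  have "act (P + Q) h x = (\<Sum>a\<in>?A. Poly_Mapping.lookup (P + Q) a * h (x - a))"
    by (intro act_superset) (use keys_add [of P Q] in auto)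
  also have "\<dots> = (\<Sum>a\<in>?A. Poly_Mapping.lookup P a * h (x - a)) + (\<Sum>a\<in>?A. Poly_Mapping.lookup Q a * h (x - a))"
    by (simp add: lookup_add distrib_right sum.distrib)
  also have "\<dots> = act P h x + act Q h x"
    by (simp add: act_superset [of ?A])
  finally show "act (P + Q) h x = act P h x + act Q h x" .
qed

lemma act_diff: "act (P - Q) h = (\<lambda>x. act P h x - act Q h x)"
  using act_add [of "P - Q" Q h] by (auto simp: fun_eq_iff algebra_simps)

lemma act_sum: "act (\<Sum>i\<in>I. P i) h = (\<lambda>x. \<Sum>i\<in>I. act (P i) h x)"
  by (induction I rule: infinite_finite_induct) (auto simp: act_add)

lemma act_zero_right [simp]: "act P (\<lambda>x. 0) = (\<lambda>x. 0)"
  by (simp add: act_def fun_eq_iff)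

lemma act_cmult: "act P (\<lambda>x. c * h x) = (\<lambda>x. c * act P h x)"
  by (auto simp: act_def sum_distrib_left algebra_simps)

lemma act_diff_right: "act P (\<lambda>x. h x - k x) = (\<lambda>x. act P h x - act P k x)"
  by (auto simp: act_def sum_subtractf algebra_simps)

lemma act_shift: "act P (\<lambda>x. h (x - a)) = (\<lambda>x. act P h (x - a))"
  by (simp add: act_def diff_diff_eq add.commute fun_eq_iff)

lemma act_mult: "act (P * Q) h = act P (act Q h)"
  using subset_UNIV [of "Poly_Mapping.keys P"]
proof (induction P rule: frag_induction)
  case (one a)
  have "act (X a * Q) h = act (X a) (act Q h)"
    using subset_UNIV [of "Poly_Mapping.keys Q"]
  proof (induction Q rule: frag_induction)
    case (one b)
    show ?case by (auto simp: mult_single diff_diff_eq add.commute)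
  next
    case (diff P Q)
    then show ?case by (simp add: right_diff_distrib act_diff)
  qed auto
  then show ?case by simp
next
  case (diff P P')
  then show ?case by (simp add: left_diff_distrib act_diff)
qed auto

lemma act_commute: "act P (act Q h) = act Q (act P h)"
  by (metis act_mult mult.commute)

lemma act_of_nat: "act (of_nat n) h = (\<lambda>x. int n * h x)"
  by (induction n) (auto simp: act_add algebra_simps)

lemma act_period_eq_0_iff: "act (1 - X w) h = (\<lambda>x. 0) \<longleftrightarrow> (\<forall>x. h (x - w) = h x)"
  by (auto simp: act_diff fun_eq_iff)

lemma bounded_config_act:
  assumes "bounded_config h"
  shows "bounded_config (act P h)"
proof -
  from assms obtain C where C: "\<And>x. \<bar>h x\<bar> \<le> C" by (auto simp: bounded_config_def)
  have "\<bar>act P h x\<bar> \<le> (\<Sum>a\<in>Poly_Mapping.keys P. \<bar>Poly_Mapping.lookup P a\<bar> * C)" for x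
    unfolding act_def
    by (rule order.trans [OF sum_abs])
      (auto simp: abs_mult intro!: sum_mono mult_left_mono C)
  then show ?thesis unfolding bounded_config_def by blast
qed

lemma scale_vec_simps [simp]:
  "scale_vec 0 a = 0" "scale_vec 1 a = a" "scale_vec k 0 = 0" "scale_vec k (scale_vec l a) = scale_vec (k * l) a"
  "scale_vec (k + l) a = scale_vec k a + scale_vec l a" "scale_vec (k - l) a = scale_vec k a - scale_vec l a"
  "scale_vec (- k) a = - scale_vec k a" "scale_vec k (- a) = - scale_vec k a"
  by (auto simp: scale_vec_def prod_eq_iff algebra_simps)

lemma scale_vec_diff: "scale_vec k (a - b) = scale_vec k a - scale_vec k b"
  by (auto simp: scale_vec_def prod_eq_iff algebra_simps)

lemma scale_vec_eq_0_iff: "scale_vec k a = 0 \<longleftrightarrow> k = 0 \<or> a = 0"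
  by (auto simp: scale_vec_def prod_eq_iff)

lemma scale_vec_cancel: "a \<noteq> 0 \<Longrightarrow> scale_vec k a = scale_vec l a \<longleftrightarrow> k = l"
  using scale_vec_eq_0_iff [of "k - l" a] by auto

lemma X_power: "X a ^ n = X (scale_vec (int n) a)"
  by (induction n) (auto simp: mult_single)

lemma period_scale:
  assumes "\<And>x. h (x - w) = h x"
  shows "h (x - scale_vec k w) = h x"
proof -
  have *: "h (x - scale_vec (int n) w) = h x" for n x
  proof (induction n)
    case (Suc n)
    then show ?case
      using assms [of "x - scale_vec (int n) w"] by (simp add: diff_diff_eq add.commute)
  qed simp
  show ?thesis
  proof (cases "k \<ge> 0")
    case True
    then show ?thesis using * [of x "nat k"] by simp
  next
    case False
    then show ?thesis using * [of "x - scale_vec k w" "nat (- k)"] by simp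
  qed
qed

lemma act_period_scale:
  assumes "act (1 - X w) h = (\<lambda>x. 0)"
  shows "act (1 - X (scale_vec k w)) h = (\<lambda>x. 0)"
  unfolding act_period_eq_0_iff
proof
  fix x
  show "h (x - scale_vec k w) = h x"
    using assms by (intro period_scale) (simp only: act_period_eq_0_iff)
qed

text \<open>Along a line in direction \<open>w\<close>, a function whose second difference vanishes is an affine
  function of the position, and a bounded affine function is constant.\<close>

lemma bounded_unipotent_imp_periodic:
  assumes "bounded_config h" and "act ((1 - X w) * (1 - X w)) h = (\<lambda>x. 0)"
  shows "act (1 - X w) h = (\<lambda>x. 0)"
proof
  fix x
  let ?d = "act (1 - X w) h"
  from assms(1) obtain C where C: "\<And>x. \<bar>h x\<bar> \<le> C" by (auto simp: bounded_config_def)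
  have "?d (x - w) = ?d x" for x
    using assms(2) by (simp add: act_mult act_period_eq_0_iff)
  then have d: "?d (x - scale_vec k w) = ?d x" for k x by (rule period_scale)
  have lin: "h (x - scale_vec (int n) w) = h x - int n * ?d x" for n
  proof (induction n)
    case (Suc n)
    then show ?case
      using d [of x "int n"] by (simp add: act_diff algebra_simps)
  qed simp
  show "?d x = 0"
  proof (rule ccontr)
    assume "?d x \<noteq> 0"
    then have "int n \<le> int n * \<bar>?d x\<bar>" for n
      by (auto simp: mult_le_cancel_left1 zero_less_abs_iff [symmetric] simp del: zero_less_abs_iff)
    moreover have "int n * \<bar>?d x\<bar> \<le> 2 * C" for n
    proof -
      have "int n * \<bar>?d x\<bar> = \<bar>h x - h (x - scale_vec (int n) w)\<bar>"
        by (simp add: lin abs_mult)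
      also have "\<dots> \<le> 2 * C" using C [of x] C [of "x - scale_vec (int n) w"] by linarith
      finally show ?thesis .
    qed
    ultimately have "int n \<le> 2 * C" for n by (meson order.trans)
    from this [of "nat (2 * C + 1)"] show False by linarith
  qed
qed

section \<open>Dilating a tile\<close>

lemma prime_dvd_add_power:
  fixes a b :: "'a::comm_ring_1"
  assumes "prime q"
  shows "of_nat q dvd (a + b) ^ q - (a ^ q + b ^ q)"
proof -
  have q: "q > 0" "{..q} = insert 0 (insert q {0<..<q})" using prime_gt_0_nat [OF assms] by auto
  have "(a + b) ^ q - (a ^ q + b ^ q) = (\<Sum>k\<in>{0<..<q}. of_nat (q choose k) * a ^ k * b ^ (q - k))"
    using q(1) by (subst binomial_ring, subst q(2)) simp
  also have "of_nat q dvd \<dots>"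
  proof (intro dvd_sum dvd_mult2)
    fix k assume "k \<in> {0<..<q}"
    then have "q dvd (q choose k)" using assms by (intro dvd_choose_prime) auto
    then show "(of_nat q :: 'a) dvd of_nat (q choose k)" by (auto elim!: dvdE)
  qed
  finally show ?thesis .
qed

lemma prime_dvd_sum_power:
  fixes Y :: "'b \<Rightarrow> 'a::comm_ring_1"
  assumes "prime q"
  shows "of_nat q dvd (\<Sum>a\<in>A. Y a) ^ q - (\<Sum>a\<in>A. Y a ^ q)"
proof (induction A rule: infinite_finite_induct)
  case (insert a A)
  have "(\<Sum>a\<in>insert a A. Y a) ^ q - (\<Sum>a\<in>insert a A. Y a ^ q)
      = ((Y a + (\<Sum>a\<in>A. Y a)) ^ q - (Y a ^ q + (\<Sum>a\<in>A. Y a) ^ q))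
        + ((\<Sum>a\<in>A. Y a) ^ q - (\<Sum>a\<in>A. Y a ^ q))"
    using insert.hyps by simp
  then show ?case
    using dvd_add [OF prime_dvd_add_power [OF assms] insert.IH] by metis
qed (use prime_gt_0_nat [OF assms] in \<open>auto simp: zero_power\<close>)

lemma prime_dvd_sum_prime_power:
  fixes Y :: "'b \<Rightarrow> 'a::comm_ring_1"
  assumes "prime q"
  shows "of_nat q dvd (\<Sum>a\<in>A. Y a) ^ (q ^ k) - (\<Sum>a\<in>A. Y a ^ (q ^ k))"
proof (induction k)
  case (Suc k)
  let ?S = "\<lambda>k. \<Sum>a\<in>A. Y a ^ (q ^ k)"
  have "of_nat q dvd ((\<Sum>a\<in>A. Y a) ^ (q ^ k)) ^ q - ?S k ^ q"
    using Suc.IH by (metis dvd_mult2 power_diff_sumr2)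
  moreover have "of_nat q dvd ?S k ^ q - ?S (Suc k)"
    using prime_dvd_sum_power [OF assms, of "\<lambda>a. Y a ^ (q ^ k)" A]
    by (simp add: power_mult [symmetric] mult.commute)
  ultimately have "of_nat q dvd (((\<Sum>a\<in>A. Y a) ^ (q ^ k)) ^ q - ?S k ^ q) + (?S k ^ q - ?S (Suc k))"
    by (rule dvd_add)
  then show ?case by (simp add: power_mult [symmetric] mult.commute)
qed auto

text \<open>The generating polynomial of the dilate of \<open>F\<close> by the factor \<open>r\<close>. The indicator function
  \<open>g\<close> of a set that \<open>F\<close> tiles with satisfies \<open>act (mask_poly F 1) g = 1\<close>.\<close>

definition mask_poly :: "vec set \<Rightarrow> nat \<Rightarrow> laurent" where
  "mask_poly F r = (\<Sum>a\<in>F. X a ^ r)"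

lemma act_mask: "act (mask_poly F r) h x = (\<Sum>a\<in>F. h (x - scale_vec (int r) a))"
  by (simp add: mask_poly_def act_sum X_power)

lemma act_mask_1: "act (mask_poly F 1) h x = (\<Sum>a\<in>F. h (x - a))"
  by (simp add: act_mask)

lemma mask_frobenius:
  assumes "prime q"
  shows "int q dvd act (mask_poly F (r * q ^ k)) h x - act (mask_poly F r ^ (q ^ k)) h x"
proof -
  have "of_nat q dvd (\<Sum>a\<in>F. X a ^ r) ^ (q ^ k) - (\<Sum>a\<in>F. (X a ^ r) ^ (q ^ k))"
    by (rule prime_dvd_sum_prime_power [OF assms])
  then obtain G where "mask_poly F r ^ (q ^ k) - mask_poly F (r * q ^ k) = of_nat q * G"
    by (auto simp: mask_poly_def power_mult elim: dvdE)
  then have "act (mask_poly F r ^ (q ^ k)) h x - act (mask_poly F (r * q ^ k)) h x = int q * act G h x"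
    by (metis act_diff act_mult act_of_nat)
  then show ?thesis by (metis dvd_diff_commute dvd_triv_left)
qed

lemma act_mask_power_one:
  assumes "act (mask_poly F r) g = (\<lambda>x. 1)"
  shows "act (mask_poly F r ^ Suc n) g = (\<lambda>x. int (card F) ^ n)"
proof (induction n)
  case (Suc n)
  have "act (mask_poly F r ^ Suc (Suc n)) g = act (mask_poly F r) (act (mask_poly F r ^ Suc n) g)"
    by (simp add: act_mult [symmetric])
  then show ?case by (simp only: Suc.IH) (simp add: fun_eq_iff act_mask)
qed (use assms in simp)

text \<open>For a prime \<open>q\<close> not dividing \<open>card F\<close>, the function \<open>h = act (mask_poly F (s * q)) g\<close> is congruent
  to a power of \<open>card F\<close> modulo \<open>q\<close>, hence nowhere zero, hence at least \<open>1\<close>; as \<open>act (mask_poly F s) h\<close>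
  is the constant \<open>card F\<close>, there is no room for a larger value.\<close>

lemma dilated_tiling_prime:
  assumes "finite F" and "prime q" "\<not> q dvd card F" and "\<And>x. g x \<ge> 0"
    and "act (mask_poly F s) g = (\<lambda>x. 1)"
  shows "act (mask_poly F (s * q)) g = (\<lambda>x. 1)"
proof
  fix y
  let ?h = "act (mask_poly F (s * q)) g"
  obtain n where n: "q = Suc n" using prime_gt_0_nat [OF assms(2)] by (cases q) auto
  have F: "F \<noteq> {}" using assms(3) by auto
  have ge1: "?h x \<ge> 1" for x
  proof -
    have "int q dvd ?h x - int (card F) ^ n"
      using mask_frobenius [OF assms(2), where k = 1 and F = F and r = s and h = g and x = x]
        act_mask_power_one [OF assms(5), of n]
      by (simp add: n)
    moreover have "\<not> int q dvd int (card F) ^ n"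
      using assms(2,3) by (metis int_dvd_int_iff of_nat_power prime_dvd_power)
    ultimately have "?h x \<noteq> 0" by (auto simp: dvd_minus_iff)
    moreover have "?h x \<ge> 0" by (auto simp: act_mask intro!: sum_nonneg assms(4))
    ultimately show ?thesis by linarith
  qed
  from F obtain a where a: "a \<in> F" by blast
  let ?x = "y + scale_vec (int s) a"
  have "act (mask_poly F s) ?h ?x = act (mask_poly F (s * q)) (act (mask_poly F s) g) ?x"
    by (simp add: act_commute)
  also have "\<dots> = int (card F)" using assms(5) by (simp add: act_mask)
  finally have "(\<Sum>b\<in>F. ?h (?x - scale_vec (int s) b) - 1) = 0"
    by (simp add: act_mask [of F s] sum_subtractf)
  then have "\<forall>b\<in>F. ?h (?x - scale_vec (int s) b) - 1 = 0"
    using ge1 by (subst (asm) sum_nonneg_eq_0_iff [OF assms(1)]) (simp_all add: le_diff_eq)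
  then show "?h y = 1" using a by auto
qed

lemma dilated_tiling:
  assumes "finite F" "F \<noteq> {}" and "\<And>x. g x \<ge> 0" and "act (mask_poly F 1) g = (\<lambda>x. 1)"
    and "coprime r (card F)" "r > 0"
  shows "act (mask_poly F r) g = (\<lambda>x. 1)"
  using assms(5,6)
proof (induction r rule: prime_divisors_induct)
  case (unit r)
  then show ?case using assms(4) by simp
next
  case (factor q r)
  then have "\<not> q dvd card F" "coprime r (card F)" "r > 0"
    by (auto simp: coprime_absorb_left prime_nat_iff dest: coprime_common_divisor)
  with factor have "act (mask_poly F (r * q)) g = (\<lambda>x. 1)"
    by (intro dilated_tiling_prime assms) auto
  then show ?case by (simp add: mult.commute)
qed auto

text \<open>The dilates of a tile by the exponents \<open>1 + n * j\<close> are a Vandermonde system in the monomials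
  \<open>X a ^ n\<close>. Combining them with the coefficients of the polynomial whose roots are the
  \<open>X a ^ n\<close> with \<open>a \<noteq> 0\<close> leaves the term \<open>a = 0\<close> only, that is, the product below.\<close>

lemma product_of_differences_annihilates:
  assumes "finite F" "0 \<in> F" "F \<noteq> {0}"
    and "\<And>j. act (mask_poly F (1 + n * j)) g = (\<lambda>x. 1)"
  shows "act (\<Prod>a\<in>F - {0}. 1 - X a ^ n) g = (\<lambda>x. 0)"
proof -
  define q :: "laurent poly" where "q = (\<Prod>a\<in>F - {0}. [:- (X a ^ n), 1:])"
  have poly_q: "poly q z = (\<Prod>a\<in>F - {0}. z - X a ^ n)" for z
    by (simp add: q_def poly_prod)
  have root: "poly q (X a ^ n) = 0" if "a \<in> F - {0}" for a
    unfolding poly_q using that assms(1) by (intro prod_zero) auto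
  have "(\<Sum>j\<le>degree q. coeff q j * mask_poly F (1 + n * j))
      = (\<Sum>a\<in>F. \<Sum>j\<le>degree q. coeff q j * X a ^ (1 + n * j))"
    by (subst sum.swap) (simp add: mask_poly_def sum_distrib_left)
  also have "\<dots> = (\<Sum>a\<in>F. X a * poly q (X a ^ n))"
    by (simp add: poly_altdef sum_distrib_left power_mult [symmetric] power_add mult_ac)
  also have "\<dots> = poly q 1"
    using root by (subst sum.remove [OF assms(1,2)]) simp
  finally have "act (poly q 1) g = act (\<Sum>j\<le>degree q. coeff q j * mask_poly F (1 + n * j)) g"
    by simp
  also have "\<dots> = act (\<Sum>j\<le>degree q. coeff q j * 1 ^ j) (\<lambda>x. 1)"
    using assms(4) by (simp add: act_sum act_mult)
  also have "\<dots> = act (poly q 1) (\<lambda>x. 1)" by (simp only: poly_altdef)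
  also have "\<dots> = (\<lambda>x. 0)"
  proof -
    from assms obtain a where a: "a \<in> F - {0}" by blast
    have "act (poly q 1) (\<lambda>x. 1)
        = act (\<Prod>b\<in>F - {0} - {a}. 1 - X b ^ n) (act (1 - X a ^ n) (\<lambda>x. 1))"
      using assms(1) a by (simp add: poly_q prod.remove [of _ a] act_mult [symmetric] mult.commute)
    then show ?thesis by (simp add: act_diff X_power)
  qed
  finally show ?thesis by (simp add: poly_q)
qed

section \<open>Directions that can be removed from an annihilating product\<close>

text \<open>For \<open>a \<noteq> 0\<close>, the level sets of \<open>wedge a\<close> are the lattice points on the lines in direction
  \<open>a\<close>, so that \<open>wedge a\<close> serves to index these lines.\<close>

definition wedge :: "vec \<Rightarrow> vec \<Rightarrow> int" where
  "wedge a b = fst a * snd b - snd a * fst b"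

lemma wedge_simps [simp]:
  "wedge a (b + c) = wedge a b + wedge a c" "wedge a (b - c) = wedge a b - wedge a c"
  "wedge a (- b) = - wedge a b" "wedge a (scale_vec k b) = k * wedge a b"
  "wedge a 0 = 0" "wedge a a = 0"
  by (auto simp: wedge_def scale_vec_def algebra_simps)

lemma wedge_swap: "wedge b a = - wedge a b"
  by (simp add: wedge_def)

lemma cramer: "scale_vec (wedge u v) a = scale_vec (wedge a v) u + scale_vec (wedge u a) v"
  by (auto simp: scale_vec_def wedge_def prod_eq_iff algebra_simps)

lemma wedge_eqD:
  assumes "wedge u v \<noteq> 0" "wedge u a = wedge u b" "wedge v a = wedge v b"
  shows "a = b"
proof -
  have "wedge (a - b) v = 0" using assms(3) by (simp add: wedge_swap [of "a - b"])
  then have "scale_vec (wedge u v) (a - b) = 0"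
    using assms(2) by (subst cramer) simp
  then show ?thesis using assms(1) by (simp add: scale_vec_eq_0_iff)
qed

lemma parallel_common_multiple:
  assumes "u \<noteq> 0" "v \<noteq> 0" "wedge u v = 0"
  obtains k l where "scale_vec k u = scale_vec l v" "scale_vec k u \<noteq> 0"
proof (cases "fst u = 0")
  case False
  then have "fst v \<noteq> 0" using assms by (auto simp: wedge_def prod_eq_iff)
  then show ?thesis
    using assms by (intro that [of "fst v" "fst u"])
      (auto simp: scale_vec_eq_0_iff, auto simp: scale_vec_def wedge_def algebra_simps)
next
  case True
  then have "snd u \<noteq> 0" using assms by (auto simp: prod_eq_iff)
  then have "snd v \<noteq> 0" using assms True by (auto simp: wedge_def prod_eq_iff)
  then show ?thesis
    using assms by (intro that [of "snd v" "snd u"])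
      (auto simp: scale_vec_eq_0_iff, auto simp: scale_vec_def wedge_def algebra_simps)
qed

lemma recurrence_zero_propagates:
  fixes t :: "int \<Rightarrow> int"
  assumes "prime p" "finite K" "k0 \<in> K" "\<And>k. k \<in> K \<Longrightarrow> k0 \<le> k \<and> k \<le> k0 + int d"
    and "\<not> int p dvd c k0"
    and rec: "\<And>i. int p dvd (\<Sum>k\<in>K. c k * t (i - k))"
    and window: "\<And>n. n < d \<Longrightarrow> int p dvd t (j + int n)"
  shows "int p dvd t (j + int n)"
proof (induction n rule: less_induct)
  case (less n)
  show ?case
  proof (cases "n < d")
    case False
    let ?i = "j + int n + k0"
    have "int p dvd (\<Sum>k\<in>K - {k0}. c k * t (?i - k))"
    proof (intro dvd_sum dvd_mult)
      fix k assume "k \<in> K - {k0}"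
      then have k: "k0 < k" "k \<le> k0 + int d" using assms(4) [of k] by auto
      then have lt: "n - nat (k - k0) < n" and eq: "?i - k = j + int (n - nat (k - k0))"
        using False by auto
      show "int p dvd t (?i - k)" unfolding eq by (rule less.IH [OF lt])
    qed
    moreover have "(\<Sum>k\<in>K. c k * t (?i - k)) = c k0 * t (j + int n) + (\<Sum>k\<in>K - {k0}. c k * t (?i - k))"
      using assms(2,3) by (subst sum.remove [of _ k0]) auto
    ultimately have "int p dvd c k0 * t (j + int n)"
      using rec [of ?i] by (simp add: dvd_add_left_iff)
    then show ?thesis
      using assms(1,5) by (simp add: prime_dvd_mult_iff)
  qed (rule window)
qed

text \<open>A window of consecutive values modulo \<open>p\<close> determines everything to its right, so that the
  first repeated window starts a period. Starting far enough to the left, this gives the period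
  at every position; the factorial is a multiple of all periods that can occur.\<close>

lemma recurrence_periodic_mod_prime:
  assumes "prime p" "finite K" "K \<noteq> {}" "\<And>k. k \<in> K \<Longrightarrow> \<not> int p dvd c k"
  obtains M :: nat where "M > 0"
    "\<And>(s::int \<Rightarrow> int) i. (\<And>i. int p dvd (\<Sum>k\<in>K. c k * s (i - k))) \<Longrightarrow> int p dvd s (i + int M) - s i"
proof -
  define d where "d = nat (Max K - Min K)"
  have K: "Min K \<le> k \<and> k \<le> Min K + int d" if "k \<in> K" for k
    using Min_le [OF assms(2) that] Max_ge [OF assms(2) that] unfolding d_def by linarith
  have Min: "Min K \<in> K" using assms by simp
  have p: "p > 0" using assms(1) by (rule prime_gt_0_nat)
  have "int p dvd s (i + int (fact (p ^ d))) - s i"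
    if rec: "\<And>i. int p dvd (\<Sum>k\<in>K. c k * s (i - k))" for s :: "int \<Rightarrow> int" and i
  proof -
    let ?N = "p ^ d"
    define w where "w n = map (\<lambda>t. s (i - int ?N + int n + int t) mod int p) [0..<d]" for n
    let ?L = "{xs. set xs \<subseteq> {0..<int p} \<and> length xs = d}"
    have "\<not> inj_on w {0..?N}"
    proof
      assume "inj_on w {0..?N}"
      moreover have "w ` {0..?N} \<subseteq> ?L" using p by (auto simp: w_def)
      ultimately have "card {0..?N} \<le> card ?L"
        by (intro card_inj_on_le [of w]) (auto intro: finite_lists_length_eq)
      also have "card ?L = ?N" using card_lists_length_eq [of "{0..<int p}" d] by simp
      finally show False by simp
    qed
    then obtain a b where "a \<le> ?N" "b \<le> ?N" "a \<noteq> b" "w a = w b" by (auto simp: inj_on_def)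
    then obtain n1 n2 where n: "n1 < n2" "n2 \<le> ?N" "w n1 = w n2"
      by (metis linorder_neqE_nat)
    define P where "P = n2 - n1"
    have P: "0 < P" "P \<le> ?N" "n2 = n1 + P" using n by (auto simp: P_def)
    define j where "j = i - int ?N + int n1"
    define t where "t x = s (x + int P) - s x" for x
    have tj: "int p dvd t (j + int n)" for n
    proof (rule recurrence_zero_propagates [where c = c and d = d and ?k0.0 = "Min K", OF assms(1,2) Min])
      show "\<not> int p dvd c (Min K)" by (rule assms(4) [OF Min])
    next
      fix x
      have "(\<Sum>k\<in>K. c k * t (x - k)) = (\<Sum>k\<in>K. c k * s ((x + int P) - k)) - (\<Sum>k\<in>K. c k * s (x - k))"
        by (simp add: t_def right_diff_distrib sum_subtractf diff_add_eq)
      then show "int p dvd (\<Sum>k\<in>K. c k * t (x - k))"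
        using dvd_diff [OF rec [of "x + int P"] rec [of x]] by simp
    next
      fix m assume m: "m < d"
      then have "w n1 ! m = w n2 ! m" using n by simp
      then have "s (j + int m) mod int p = s (j + int m + int P) mod int p"
        using m by (simp add: w_def j_def P algebra_simps)
      then show "int p dvd t (j + int m)"
        unfolding t_def by (metis mod_eq_dvd_iff)
    qed (rule K)
    have step: "int p dvd s (x + int P) - s x" if "x \<ge> i" for x
    proof -
      have "int n1 \<le> int ?N" using n by (subst of_nat_le_iff) linarith
      then have "j + int (nat (x - j)) = x" using that unfolding j_def by linarith
      then show ?thesis using tj [of "nat (x - j)"] by (simp add: t_def)
    qed
    have "int p dvd s (i + int (q * P)) - s i" for q
    proof (induction q)
      case (Suc q)
      then show ?case
        using dvd_add [OF step [of "i + int (q * P)"] Suc.IH] by (simp add: algebra_simps)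
    qed simp
    moreover have "P dvd fact ?N" using P by (intro dvd_fact) auto
    then obtain q where "fact ?N = q * P" by (metis dvdE mult.commute)
    ultimately show ?thesis by simp
  qed
  then show ?thesis by (intro that [of "fact (p ^ d)"]) auto
qed

text \<open>These are the functions that arise when all factors but the one of \<open>u\<close> of an annihilating
  product are applied to a tiling: the remaining factor makes them \<open>u\<close>-periodic, and the
  differences that were applied turn the constant right-hand sides of the dilated tiling equations
  into \<open>0\<close>.\<close>

definition dilation_kernel :: "nat \<Rightarrow> vec set \<Rightarrow> vec \<Rightarrow> (vec \<Rightarrow> int) set" where
  "dilation_kernel p F u = {h. (\<forall>x. h (x - u) = h x) \<and>
     (\<forall>r>0. coprime r p \<longrightarrow> act (mask_poly F r) h = (\<lambda>x. 0))}"

lemma dilation_kernel_cancel: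
  assumes "(\<lambda>x. c * h x) \<in> dilation_kernel p F u" "c \<noteq> 0"
  shows "h \<in> dilation_kernel p F u"
  using assms by (auto simp: dilation_kernel_def act_cmult fun_eq_iff)

lemma dilation_kernel_diff_shift:
  assumes "h \<in> dilation_kernel p F u"
  shows "(\<lambda>x. h x - h (x - a)) \<in> dilation_kernel p F u"
proof -
  have per: "h (x - u) = h x" for x using assms by (simp add: dilation_kernel_def)
  have "h (x - u - a) = h (x - a)" for x
    using per [of "x - a"] by (simp add: diff_diff_eq add.commute)
  moreover have "act (mask_poly F r) (\<lambda>x. h x - h (x - a)) = (\<lambda>x. 0)" if "r > 0" "coprime r p" for r
    unfolding act_diff_right act_shift using assms that by (simp add: dilation_kernel_def)
  ultimately show ?thesis by (simp add: dilation_kernel_def per)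
qed

definition divisible_line_counts :: "nat \<Rightarrow> vec set \<Rightarrow> vec \<Rightarrow> bool" where
  "divisible_line_counts p F u \<longleftrightarrow> (\<forall>k. p dvd card {a \<in> F. wedge u a = k})"

text \<open>Let \<open>wedge u v = p ^ e * m\<close> with \<open>m\<close> prime to \<open>p\<close>. The dilate of \<open>F\<close> by \<open>m\<close> annihilates \<open>h\<close>,
  hence by Frobenius the dilate by \<open>wedge u v\<close> annihilates \<open>h\<close> modulo \<open>p\<close>. By Cramer's rule,
  translating by \<open>scale_vec (wedge u v) a\<close> is the same, for a \<open>u\<close>-periodic \<open>h\<close>, as translating by a
  multiple of \<open>v\<close> that depends only on the line in direction \<open>u\<close> through \<open>a\<close>.\<close>

lemma line_count_recurrence:
  assumes "prime p" "finite F" "wedge u v > 0" "h \<in> dilation_kernel p F u"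
  shows "int p dvd (\<Sum>k\<in>wedge u ` F. int (card {a \<in> F. wedge u a = k}) * h (x - scale_vec k v))"
proof -
  obtain m e where m: "nat (wedge u v) = m * p ^ e" "\<not> p dvd m"
  proof (rule multiplicity_decompose' [of "nat (wedge u v)" p])
    show "nat (wedge u v) \<noteq> 0" "\<not> is_unit p" using assms(1,3) by auto
  qed (use that in \<open>auto simp: mult.commute\<close>)
  have "m > 0" "coprime m p"
    using m assms(1,3) prime_imp_coprime [OF assms(1)] by (auto simp: coprime_commute intro: Nat.gr0I)
  then have zero: "act (mask_poly F m) h = (\<lambda>x. 0)"
    using assms(4) by (simp add: dilation_kernel_def)
  have "act (mask_poly F m ^ (p ^ e)) h = (\<lambda>x. 0)"
  proof -
    obtain n where n: "p ^ e = Suc n" using prime_gt_0_nat [OF assms(1)] by (cases "p ^ e") auto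
    show ?thesis unfolding n power_Suc2 by (simp add: act_mult zero)
  qed
  then have "int p dvd act (mask_poly F (m * p ^ e)) h x"
    using mask_frobenius [OF assms(1), of F m e h x] by simp
  also have "act (mask_poly F (m * p ^ e)) h x = (\<Sum>a\<in>F. h (x - scale_vec (wedge u v) a))"
    using assms(3) by (simp add: act_mask m(1) [symmetric])
  also have "\<dots> = (\<Sum>a\<in>F. h (x - scale_vec (wedge u a) v))"
  proof (rule sum.cong [OF refl])
    fix a
    have "h (y - scale_vec (wedge a v) u) = h y" for y
      using assms(4) by (intro period_scale) (simp add: dilation_kernel_def)
    from this [of "x - scale_vec (wedge u a) v"]
    show "h (x - scale_vec (wedge u v) a) = h (x - scale_vec (wedge u a) v)"
      by (subst cramer) (simp add: algebra_simps)
  qed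
  also have "\<dots> = (\<Sum>k\<in>wedge u ` F. \<Sum>a\<in>{a \<in> F. wedge u a = k}. h (x - scale_vec (wedge u a) v))"
    by (rule sum.image_gen [OF assms(2)])
  also have "\<dots> = (\<Sum>k\<in>wedge u ` F. int (card {a \<in> F. wedge u a = k}) * h (x - scale_vec k v))"
    by (intro sum.cong) auto
  finally show ?thesis .
qed

text \<open>Modulo \<open>p\<close> the coefficients divisible by \<open>p\<close> drop out of the recurrence, and one that is
  not divisible remains. The period does not depend on \<open>h\<close>, which is what allows to iterate.\<close>

lemma dilation_kernel_period_mod_prime:
  assumes "prime p" "finite F" "wedge u v > 0" "\<not> divisible_line_counts p F u"
  obtains M :: int where "M > 0"
    "\<And>h x. h \<in> dilation_kernel p F u \<Longrightarrow> int p dvd h x - h (x - scale_vec M v)"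
proof -
  define c where "c k = int (card {a \<in> F. wedge u a = k})" for k
  define K where "K = {k \<in> wedge u ` F. \<not> int p dvd c k}"
  have fin: "finite K" using assms(2) by (simp add: K_def)
  have "K \<noteq> {}"
  proof -
    obtain k where k: "\<not> p dvd card {a \<in> F. wedge u a = k}"
      using assms(4) by (auto simp: divisible_line_counts_def)
    then have "{a \<in> F. wedge u a = k} \<noteq> {}" by (metis card.empty dvd_0_right)
    with k show ?thesis by (auto simp: K_def c_def)
  qed
  then obtain M where M: "M > 0"
    "\<And>(s::int \<Rightarrow> int) i. (\<And>i. int p dvd (\<Sum>k\<in>K. c k * s (i - k))) \<Longrightarrow> int p dvd s (i + int M) - s i"
  proof (rule recurrence_periodic_mod_prime [OF assms(1) fin])
    show "\<not> int p dvd c k" if "k \<in> K" for k using that by (simp add: K_def)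
  qed (use that in blast)
  have "int p dvd h x - h (x - scale_vec (int M) v)" if h: "h \<in> dilation_kernel p F u" for h x
  proof -
    have "int p dvd (\<Sum>k\<in>K. c k * h (x + scale_vec (i - k) v))" for i
    proof -
      let ?y = "x + scale_vec i v"
      have "(\<Sum>k\<in>wedge u ` F. c k * h (?y - scale_vec k v))
          = (\<Sum>k\<in>wedge u ` F - K. c k * h (?y - scale_vec k v)) + (\<Sum>k\<in>K. c k * h (?y - scale_vec k v))"
        using assms(2) by (intro sum.subset_diff) (auto simp: K_def)
      moreover have "int p dvd (\<Sum>k\<in>wedge u ` F - K. c k * h (?y - scale_vec k v))"
        by (intro dvd_sum dvd_mult2) (auto simp: K_def)
      moreover have "int p dvd (\<Sum>k\<in>wedge u ` F. c k * h (?y - scale_vec k v))"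
        unfolding c_def by (rule line_count_recurrence [OF assms(1-3) h])
      ultimately have "int p dvd (\<Sum>k\<in>K. c k * h (?y - scale_vec k v))"
        by (simp add: dvd_add_right_iff)
      then show ?thesis by (simp add: algebra_simps)
    qed
    then have "int p dvd h (x + scale_vec (- int M + int M) v) - h (x + scale_vec (- int M) v)"
      by (rule M(2) [of "\<lambda>i. h (x + scale_vec i v)" "- int M"])
    then show ?thesis by simp
  qed
  with M(1) show ?thesis by (intro that [of "int M"]) auto
qed

text \<open>If \<open>S\<close> is a translation with \<open>S \<equiv> 1\<close> modulo \<open>p ^ (e + 1)\<close> on the kernel, then
  \<open>1 - S ^ p = (1 - S) * (1 + S + \<dots> + S ^ (p - 1))\<close> gains a factor \<open>p\<close>. The kernel is closed
  under division by \<open>p ^ (e + 1)\<close>, so that the congruence applies to the quotient as well.\<close>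

lemma dilation_kernel_period_mod_prime_power:
  assumes "prime p" "finite F" "wedge u v > 0" "\<not> divisible_line_counts p F u"
  shows "\<exists>L>0. \<forall>h\<in>dilation_kernel p F u. \<forall>x. int p ^ Suc e dvd h x - h (x - scale_vec L v)"
proof (induction e)
  case 0
  obtain M :: int where "M > 0"
    "\<And>h x. h \<in> dilation_kernel p F u \<Longrightarrow> int p dvd h x - h (x - scale_vec M v)"
    using dilation_kernel_period_mod_prime [OF assms] by blast
  then show ?case by (intro exI [of _ M]) simp
next
  case (Suc e)
  then obtain L where L: "L > 0"
    "\<And>h x. h \<in> dilation_kernel p F u \<Longrightarrow> int p ^ Suc e dvd h x - h (x - scale_vec L v)" by blast
  have p: "p > 0" using assms(1) by (rule prime_gt_0_nat)
  have "int p ^ Suc (Suc e) dvd h x - h (x - scale_vec (int p * L) v)"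
    if h: "h \<in> dilation_kernel p F u" for h x
  proof -
    define h' where "h' x = (h x - h (x - scale_vec L v)) div int p ^ Suc e" for x
    have h': "h x - h (x - scale_vec L v) = int p ^ Suc e * h' x" for x
      unfolding h'_def using L(2) [OF h, of x] by (simp only: dvd_mult_div_cancel)
    have "(\<lambda>x. int p ^ Suc e * h' x) \<in> dilation_kernel p F u"
      using dilation_kernel_diff_shift [OF h] by (simp only: h' [symmetric])
    then have "h' \<in> dilation_kernel p F u"
      by (rule dilation_kernel_cancel) (use p in simp)
    then have "int p ^ Suc e dvd h' x - h' (x - scale_vec L v)" for x by (rule L(2))
    then have pdvd: "int p dvd h' x - h' (x - scale_vec L v)" for x
      using dvd_trans [OF dvd_power [of "Suc e" "int p"]] by blast
    have cong: "int p dvd h' x - h' (x - scale_vec (int i * L) v)" for i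
    proof (induction i)
      case (Suc i)
      then show ?case
        using dvd_add [OF Suc.IH pdvd [of "x - scale_vec (int i * L) v"]]
        by (simp add: algebra_simps)
    qed simp
    have "h x - h (x - scale_vec (int n * L) v)
        = int p ^ Suc e * (\<Sum>i<n. h' (x - scale_vec (int i * L) v))" for n
    proof (induction n)
      case (Suc n)
      then show ?case
        using h' [of "x - scale_vec (int n * L) v"] by (simp add: algebra_simps)
    qed simp
    moreover have "int p dvd (\<Sum>i<p. h' (x - scale_vec (int i * L) v))"
    proof -
      have "int p dvd int p * h' x - (\<Sum>i<p. h' x - h' (x - scale_vec (int i * L) v))"
        by (intro dvd_diff dvd_sum cong) simp
      then show ?thesis by (simp add: sum_subtractf)
    qed
    ultimately show ?thesis by (simp only: power_Suc2 [of _ "Suc e"] mult_dvd_mono dvd_refl)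
  qed
  with L(1) p show ?case by (intro exI [of _ "int p * L"]) auto
qed

text \<open>A bounded function that agrees with a translate of itself modulo a large enough power of \<open>p\<close>
  is equal to it.\<close>

lemma bounded_dilation_kernel_periodic:
  assumes "prime p" "finite F" "wedge u v \<noteq> 0" "\<not> divisible_line_counts p F u"
    and "h \<in> dilation_kernel p F u" "bounded_config h"
  obtains L where "L > 0" "\<And>x. h (x - scale_vec L v) = h x"
proof -
  have pos: "\<exists>L>0. \<forall>x. h (x - scale_vec L v) = h x" if uv: "wedge u v > 0" for v
  proof -
    from assms(6) obtain C where C: "\<And>x. \<bar>h x\<bar> \<le> C" by (auto simp: bounded_config_def)
    define e where "e = nat (2 * C)"
    have large: "2 * C < int p ^ Suc e"
    proof -
      have "2 * C \<le> int e" by (simp add: e_def)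
      also have "\<dots> < int (2 ^ e)" by (subst of_nat_less_iff) (rule less_exp)
      also have "2 ^ e \<le> p ^ e" by (intro power_mono prime_ge_2_nat assms(1)) auto
      also have "p ^ e \<le> p ^ Suc e"
        using prime_gt_0_nat [OF assms(1)] by (intro power_increasing) auto
      finally show ?thesis by simp
    qed
    obtain L where L: "L > 0" "\<And>x. int p ^ Suc e dvd h x - h (x - scale_vec L v)"
      using dilation_kernel_period_mod_prime_power [OF assms(1,2) uv assms(4), of e] assms(5) by blast
    have "h x - h (x - scale_vec L v) = 0" for x
    proof (rule ccontr)
      assume "h x - h (x - scale_vec L v) \<noteq> 0"
      then have "\<bar>int p ^ Suc e\<bar> \<le> \<bar>h x - h (x - scale_vec L v)\<bar>"
        by (rule dvd_imp_le_int [OF _ L(2)])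
      also have "\<dots> \<le> 2 * C" using C [of x] C [of "x - scale_vec L v"] by linarith
      finally show False using large by linarith
    qed
    with L(1) show ?thesis by (intro exI [of _ L]) auto
  qed
  show ?thesis
  proof (cases "wedge u v > 0")
    case True
    then show ?thesis using pos that by blast
  next
    case False
    then have "wedge u (- v) > 0" using assms(3) by simp
    then obtain L where L: "L > 0" "\<And>x. h (x - scale_vec L (- v)) = h x"
      using pos by blast
    have "h (x - scale_vec L v) = h x" for x
      using L(2) [of "x - scale_vec L v"] by simp
    with L(1) show ?thesis by (rule that)
  qed
qed

text \<open>In an annihilating product of differences, two parallel factors merge into one, by
  boundedness of \<open>g\<close>. If some line in direction \<open>u\<close> meets \<open>F\<close> in a number of points not divisible
  by \<open>p\<close>, then the factor of \<open>u\<close> can be traded for a second factor in the direction of another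
  vector \<open>v\<close>, and these two merge. So the product shrinks until one factor is left, or two
  non-parallel directions have all their line counts divisible by \<open>p\<close>.\<close>

lemma periodic_or_two_divisible_directions:
  assumes "prime p" "finite F" "bounded_config g"
    and dil: "\<And>r. r > 0 \<Longrightarrow> coprime r p \<Longrightarrow> act (mask_poly F r) g = (\<lambda>x. 1)"
    and "finite A" "0 \<notin> A" "u \<noteq> 0"
    and "act ((1 - X u) * (\<Prod>a\<in>A. 1 - X a)) g = (\<lambda>x. 0)"
  shows "(\<exists>w. w \<noteq> 0 \<and> (\<forall>x. g (x - w) = g x)) \<or>
    (\<exists>u v. wedge u v \<noteq> 0 \<and> divisible_line_counts p F u \<and> divisible_line_counts p F v)"
  using assms(5-8)
proof (induction A arbitrary: u rule: finite_induct)
  case empty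
  then show ?case by (auto simp: act_period_eq_0_iff)
next
  case (insert v A)
  define Q where "Q = (\<Prod>a\<in>A. 1 - X a)"
  have v: "v \<noteq> 0" "0 \<notin> A" using insert.prems by auto
  have prod: "act ((1 - X u) * (1 - X v) * Q) g = (\<lambda>x. 0)"
    using insert.prems insert.hyps by (simp add: Q_def mult_ac)
  have bnd: "bounded_config (act P g)" for P by (rule bounded_config_act [OF assms(3)])
  have merge: ?case if "w \<noteq> 0" "act ((1 - X w) * (1 - X w) * Q) g = (\<lambda>x. 0)" for w
  proof (rule insert.IH [OF v(2) that(1)])
    show "act ((1 - X w) * (\<Prod>a\<in>A. 1 - X a)) g = (\<lambda>x. 0)"
      using bounded_unipotent_imp_periodic [OF bnd, of w Q] that(2)
      by (simp add: act_mult Q_def)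
  qed
  have trade: ?case
    if uv: "wedge u v \<noteq> 0" "\<not> divisible_line_counts p F u" "v \<noteq> 0"
      "act ((1 - X u) * (1 - X v) * Q) g = (\<lambda>x. 0)" for u v
  proof -
    let ?h = "act ((1 - X v) * Q) g"
    have "act (mask_poly F r) ?h = (\<lambda>x. 0)" if "r > 0" "coprime r p" for r
    proof -
      have "act (mask_poly F r) ?h = act (Q * (1 - X v)) (act (mask_poly F r) g)"
        by (subst act_commute) (simp add: mult.commute)
      also have "\<dots> = act Q (act (1 - X v) (\<lambda>x. 1))" by (simp add: dil that act_mult)
      finally show ?thesis by (simp add: act_diff)
    qed
    then have "?h \<in> dilation_kernel p F u"
      using uv(4) by (simp add: dilation_kernel_def mult.assoc act_mult act_period_eq_0_iff)
    then obtain L where L: "L > 0" "\<And>x. ?h (x - scale_vec L v) = ?h x"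
      using bounded_dilation_kernel_periodic [OF assms(1,2) uv(1,2) _ bnd] by blast
    let ?w = "scale_vec L v"
    have w0: "act (1 - X ?w) ?h = (\<lambda>x. 0)" using L(2) by (simp add: act_period_eq_0_iff)
    have "act (1 - X v) (act ((1 - X ?w) * Q) g) = act (1 - X ?w) ?h"
      by (simp add: act_mult [symmetric] mult_ac)
    also have "\<dots> = (\<lambda>x. 0)" by (rule w0)
    finally have "act (1 - X ?w) (act ((1 - X ?w) * Q) g) = (\<lambda>x. 0)"
      by (rule act_period_scale)
    then show ?case
      using L(1) uv(3) by (intro merge [of ?w]) (auto simp: scale_vec_eq_0_iff act_mult)
  qed
  consider "wedge u v = 0" | "wedge u v \<noteq> 0" "\<not> divisible_line_counts p F u"
    | "wedge u v \<noteq> 0" "\<not> divisible_line_counts p F v"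
    | "wedge u v \<noteq> 0" "divisible_line_counts p F u" "divisible_line_counts p F v" by blast
  then show ?case
  proof cases
    case 1
    then obtain k l where kl: "scale_vec k u = scale_vec l v" "scale_vec k u \<noteq> 0"
      using parallel_common_multiple insert.prems(2) v(1) by metis
    let ?w = "scale_vec k u"
    have "act (1 - X u) (act ((1 - X v) * Q) g) = (\<lambda>x. 0)"
      using prod by (simp add: act_mult)
    then have "act (1 - X ?w) (act ((1 - X v) * Q) g) = (\<lambda>x. 0)"
      by (rule act_period_scale)
    then have "act (1 - X v) (act ((1 - X ?w) * Q) g) = (\<lambda>x. 0)"
      by (simp add: act_mult [symmetric] mult_ac)
    then have "act (1 - X ?w) (act ((1 - X ?w) * Q) g) = (\<lambda>x. 0)"
      unfolding kl(1) by (rule act_period_scale)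
    then show ?thesis using kl(2) by (intro merge [of ?w]) (auto simp: act_mult)
  next
    case 2
    then show ?thesis using trade v(1) prod by blast
  next
    case 3
    then show ?thesis
      using trade [of v u] insert.prems(2) prod by (simp add: wedge_swap [of v u] mult_ac)
  qed blast
qed

section \<open>Clusters with two divisible directions\<close>

text \<open>The line in direction \<open>v\<close> through the origin contains at least \<open>p\<close> points, which lie on
  different lines in direction \<open>u\<close>. Each of those contains at least \<open>p\<close> points as well, and there
  are only \<open>p\<^sup>2\<close> points in all, so that equality holds everywhere.\<close>

lemma axis_of_divisible_directions:
  assumes "prime p" "finite F" "0 \<in> F" "card F = p\<^sup>2" "wedge u v \<noteq> 0"
    and "divisible_line_counts p F u" "divisible_line_counts p F v"
  defines "B \<equiv> {b \<in> F. wedge v b = 0}"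
  shows "card B = p" and "wedge u ` B = wedge u ` F"
proof -
  let ?line = "\<lambda>k. {a \<in> F. wedge u a = k}"
  have p: "p > 0" using assms(1) by (rule prime_gt_0_nat)
  have fin: "finite B" using assms(2) by (simp add: B_def)
  have "card B \<ge> p"
  proof (rule dvd_imp_le)
    show "p dvd card B" using assms(7) by (simp add: divisible_line_counts_def B_def)
    show "0 < card B" using fin assms(3) by (auto simp: card_gt_0_iff B_def)
  qed
  have inj: "inj_on (wedge u) B"
    by (rule inj_onI, rule wedge_eqD [OF assms(5)]) (simp_all add: B_def)
  then have le: "card B \<le> card (wedge u ` F)"
    using assms(2) by (intro card_inj_on_le [of "wedge u"]) (auto simp: B_def)
  have "p * card (wedge u ` F) = (\<Sum>k\<in>wedge u ` F. p)" by simp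
  also have "\<dots> \<le> (\<Sum>k\<in>wedge u ` F. card (?line k))"
  proof (rule sum_mono)
    fix k assume "k \<in> wedge u ` F"
    then have "0 < card (?line k)" using assms(2) by (auto simp: card_gt_0_iff)
    then show "p \<le> card (?line k)"
      using assms(6) by (intro dvd_imp_le) (auto simp: divisible_line_counts_def)
  qed
  also have "\<dots> = card F"
    using sum.image_gen [OF assms(2), of "\<lambda>_. 1::nat" "wedge u"] by simp
  finally have "card (wedge u ` F) \<le> p" using p by (simp add: assms(4) power2_eq_square)
  with \<open>card B \<ge> p\<close> le have eq: "card B = p" "card (wedge u ` F) = p" by linarith+
  show "card B = p" by (rule eq)
  show "wedge u ` B = wedge u ` F"
    by (rule card_subset_eq) (use assms(2) eq card_image [OF inj] in \<open>auto simp: B_def\<close>)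
qed

text \<open>A point of \<open>F\<close> is determined by its lines in the directions \<open>u\<close> and \<open>v\<close>. All lines that
  meet \<open>F\<close> already occur for points of the two axes, so every point of \<open>F\<close> is a sum of
  points of the axes, and by \<open>card F = p\<^sup>2\<close> there is no other sum.\<close>

lemma product_of_axes:
  assumes "prime p" "finite F" "0 \<in> F" "card F = p\<^sup>2" "wedge u v \<noteq> 0"
    and "divisible_line_counts p F u" "divisible_line_counts p F v"
  defines "A \<equiv> {a \<in> F. wedge u a = 0}" and "B \<equiv> {b \<in> F. wedge v b = 0}"
  shows "bij_betw (\<lambda>(a, b). a + b) (A \<times> B) F"
proof -
  let ?f = "\<lambda>(a, b). a + b :: vec"
  have vu: "wedge v u \<noteq> 0" using assms(5) by (simp add: wedge_swap [of v u])
  note B = axis_of_divisible_directions [OF assms(1-7), folded B_def]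
  note A = axis_of_divisible_directions [OF assms(1-4) vu assms(7,6), folded A_def]
  have fin: "finite (A \<times> B)" using assms(2) by (simp add: A_def B_def)
  have sub: "F \<subseteq> ?f ` (A \<times> B)"
  proof
    fix f assume "f \<in> F"
    then obtain a b where a: "a \<in> A" "wedge v a = wedge v f" and b: "b \<in> B" "wedge u b = wedge u f"
      using A(2) B(2) by (metis (no_types, lifting) imageE imageI)
    then have "wedge u (a + b) = wedge u f" "wedge v (a + b) = wedge v f"
      by (auto simp: A_def B_def)
    then have "a + b = f" by (rule wedge_eqD [OF assms(5)])
    with a b show "f \<in> ?f ` (A \<times> B)" by force
  qed
  have card: "card (A \<times> B) = card F"
    by (simp add: card_cartesian_product A B assms(4) power2_eq_square)
  have "card (?f ` (A \<times> B)) \<le> card F" using card_image_le [OF fin, of ?f] card by simp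
  then have eq: "F = ?f ` (A \<times> B)"
    using fin sub by (intro card_seteq) auto
  then have "inj_on ?f (A \<times> B)"
    using fin card by (intro eq_card_imp_inj_on [OF fin]) (simp only: eq [symmetric] card)
  with eq show ?thesis by (metis bij_betw_def)
qed

text \<open>The power \<open>mask_poly A 1 ^ p\<close> maps \<open>h\<close> to the constant \<open>p ^ (p - 1)\<close>, so by Frobenius the
  sum of the \<open>p\<close> values \<open>h (x - scale_vec p a) \<in> {0, 1}\<close> is divisible by \<open>p\<close>. Hence these values
  are all \<open>0\<close> or all \<open>1\<close>.\<close>

lemma prime_tile_period:
  assumes "prime p" "finite A" "card A = p" "\<And>x. h x \<ge> 0" "act (mask_poly A 1) h = (\<lambda>x. 1)"
    and "a \<in> A" "b \<in> A"
  shows "h (x - scale_vec (int p) a) = h (x - scale_vec (int p) b)"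
proof -
  have le1: "h y \<le> 1" for y
  proof -
    have "h y = h (y + a - a)" by simp
    also have "\<dots> \<le> (\<Sum>b\<in>A. h (y + a - b))"
      by (rule member_le_sum [OF assms(6)]) (auto simp: assms)
    also have "\<dots> = 1" using assms(5) by (metis act_mask_1)
    finally show ?thesis .
  qed
  define S where "S = (\<Sum>a\<in>A. h (x - scale_vec (int p) a))"
  have "int p dvd S - act (mask_poly A 1 ^ p) h x"
    using mask_frobenius [OF assms(1), of A 1 1 h x] by (simp add: S_def act_mask)
  moreover obtain n where n: "p = Suc (Suc n)"
    using prime_ge_2_nat [OF assms(1)] by (metis Suc_diff_Suc add_2_eq_Suc le_add_diff_inverse)
  then have "int p dvd act (mask_poly A 1 ^ p) h x"
    using act_mask_power_one [OF assms(5), of "Suc n"] by (simp add: assms(3))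
  ultimately have "int p dvd S" by (metis dvd_diff_left_iff dvd_diffD)
  moreover have "S \<ge> 0" unfolding S_def by (intro sum_nonneg assms)
  moreover have "S \<le> int p"
    using sum_bounded_above [of A "\<lambda>a. h (x - scale_vec (int p) a)" 1] le1 by (simp add: S_def assms(3))
  ultimately consider "S = 0" | "S = int p"
    by (metis dvd_imp_le_int abs_of_nonneg antisym of_nat_0_le_iff)
  then show ?thesis
  proof cases
    case 1
    then have "\<forall>a\<in>A. h (x - scale_vec (int p) a) = 0"
      unfolding S_def using assms(4) by (subst (asm) sum_nonneg_eq_0_iff [OF assms(2)]) auto
    then show ?thesis using assms by simp
  next
    case 2
    then have "(\<Sum>a\<in>A. 1 - h (x - scale_vec (int p) a)) = 0"
      by (simp add: S_def sum_subtractf assms(3))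
    then have "\<forall>a\<in>A. 1 - h (x - scale_vec (int p) a) = 0"
      using le1 by (subst (asm) sum_nonneg_eq_0_iff [OF assms(2)]) auto
    then show ?thesis using assms by simp
  qed
qed

text \<open>At two positions that are congruent modulo \<open>p\<close>, the periodic function \<open>h\<close> takes the same
  value. If both occurred in the sum, which is \<open>1\<close>, this value would be \<open>0\<close>; so \<open>h\<close> would
  vanish identically, and the sum with it.\<close>

lemma tile_complete_residues:
  fixes h :: "vec \<Rightarrow> int"
  assumes "finite I" "card I = p" "p > 0" and nonneg: "\<And>x. h x \<ge> 0"
    and period: "\<And>x. h (x - scale_vec (int p) e) = h x"
    and tile: "\<And>x. (\<Sum>i\<in>I. h (x - scale_vec i e)) = 1"
  shows "bij_betw (\<lambda>i. i mod int p) I {0..<int p}"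
proof -
  have eq: "h (x - scale_vec i e) = h (x - scale_vec j e)" if "i mod int p = j mod int p" for i j x
  proof -
    from that obtain k where k: "i = j + k * int p" by (metis mod_eqE mult.commute add.commute diff_add_cancel mod_eq_dvd_iff dvdE)
    have "h (x - scale_vec j e - scale_vec k (scale_vec (int p) e)) = h (x - scale_vec j e)"
      using period by (rule period_scale)
    then show ?thesis by (simp add: k algebra_simps)
  qed
  have inj: "inj_on (\<lambda>i. i mod int p) I"
  proof (rule inj_onI, rule ccontr)
    fix i j assume ij: "i \<in> I" "j \<in> I" "i mod int p = j mod int p" "i \<noteq> j"
    have zero: "h y = 0" for y
    proof -
      let ?x = "y + scale_vec i e"
      have "(\<Sum>k\<in>{i, j}. h (?x - scale_vec k e)) \<le> (\<Sum>k\<in>I. h (?x - scale_vec k e))"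
        by (rule sum_mono2 [OF assms(1)]) (use ij nonneg in auto)
      then have "h (?x - scale_vec i e) + h (?x - scale_vec j e) \<le> 1"
        using tile [of ?x] ij(4) by simp
      then show ?thesis using eq [OF ij(3), of ?x] nonneg [of y] by simp
    qed
    show False using tile [of 0] by (simp add: zero)
  qed
  have "(\<lambda>i. i mod int p) ` I = {0..<int p}"
  proof (rule card_subset_eq)
    show "card ((\<lambda>i. i mod int p) ` I) = card {0..<int p}" by (simp add: card_image [OF inj] assms(2))
  qed (use assms(3) in auto)
  with inj show ?thesis by (simp add: bij_betw_def)
qed

lemma sum_over_residues:
  assumes "bij_betw (\<lambda>i. i mod int p) I {0..<int p}"
    and period: "\<And>x. h (x - scale_vec (int p) e) = h x"
  shows "(\<Sum>i<p. h (x - scale_vec (int i) e)) = (\<Sum>i\<in>I. h (x - scale_vec i e))"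
proof -
  have eq: "h (x - scale_vec (i mod int p) e) = h (x - scale_vec i e)" for i
  proof -
    have "h (x - scale_vec (i mod int p) e - scale_vec (i div int p) (scale_vec (int p) e))
        = h (x - scale_vec (i mod int p) e)"
      using period by (rule period_scale)
    moreover have "scale_vec (i mod int p) e + scale_vec (i div int p) (scale_vec (int p) e) = scale_vec i e"
      by (simp flip: scale_vec_simps(5))
    ultimately show ?thesis by (metis diff_diff_eq)
  qed
  have "(\<Sum>i<p. h (x - scale_vec (int i) e)) = (\<Sum>i\<in>{0..<int p}. h (x - scale_vec i e))"
    by (rule sum.reindex_bij_witness [of _ nat int]) auto
  also have "\<dots> = (\<Sum>i\<in>I. h (x - scale_vec (i mod int p) e))"
    using sum.reindex_bij_betw [OF assms(1), of "\<lambda>i. h (x - scale_vec i e)"] by simp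
  finally show ?thesis by (simp add: eq)
qed

lemma spanning_set_closed_under_diff:
  assumes "group_closure {a - b |a b. a \<in> F \<and> b \<in> F} = UNIV" "F \<subseteq> S" "0 \<in> S"
    and diff: "\<And>x y. x \<in> S \<Longrightarrow> y \<in> S \<Longrightarrow> x - y \<in> S"
  shows "x \<in> S"
proof -
  have "x \<in> group_closure {a - b |a b. a \<in> F \<and> b \<in> F}" by (simp add: assms(1))
  then show ?thesis
  proof induction
    case (base s)
    then show ?case using assms(2,3) diff by auto
  qed (rule diff)
qed

lemma wedge_independent:
  assumes "wedge \<alpha> \<beta> \<noteq> 0" "scale_vec k \<alpha> + scale_vec l \<beta> = scale_vec k' \<alpha> + scale_vec l' \<beta>"
  shows "k = k'" "l = l'"
proof -
  have "wedge \<alpha> (scale_vec k \<alpha> + scale_vec l \<beta>) = wedge \<alpha> (scale_vec k' \<alpha> + scale_vec l' \<beta>)"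
    "wedge \<beta> (scale_vec k \<alpha> + scale_vec l \<beta>) = wedge \<beta> (scale_vec k' \<alpha> + scale_vec l' \<beta>)"
    by (simp_all only: assms(2))
  then show "k = k'" "l = l'"
    using assms(1) by (simp_all add: wedge_swap [of \<beta> \<alpha>])
qed

text \<open>The vectors whose coordinate along \<open>\<alpha>\<close> lies in the subgroup \<open>S\<close> form a subgroup that
  contains \<open>F\<close>, hence also \<open>\<alpha>\<close>. With the multipliers \<open>k\<close> for which a function has the period \<open>scale_vec (k * p) \<alpha>\<close> as \<open>S\<close>, this
  turns the periods found along single elements of the tile into one along \<open>\<alpha>\<close>.\<close>

lemma one_in_coordinate_group:
  assumes "group_closure {a - b |a b. a \<in> F \<and> b \<in> F} = UNIV" "wedge \<alpha> \<beta> \<noteq> 0"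
    and F: "\<And>f. f \<in> F \<Longrightarrow> \<exists>k\<in>S. \<exists>l. f = scale_vec k \<alpha> + scale_vec l \<beta>"
    and S: "0 \<in> S" "\<And>k l. k \<in> S \<Longrightarrow> l \<in> S \<Longrightarrow> k - l \<in> S"
  shows "1 \<in> S"
proof -
  let ?S = "{scale_vec k \<alpha> + scale_vec l \<beta> |k l. k \<in> S}"
  have "\<alpha> \<in> ?S"
  proof (rule spanning_set_closed_under_diff [OF assms(1)])
    show "F \<subseteq> ?S" using F by blast
    show "0 \<in> ?S" using S(1) by (auto intro!: exI [of _ 0])
    fix x y assume "x \<in> ?S" "y \<in> ?S"
    then obtain k l k' l' where "k \<in> S" "k' \<in> S"
      "x = scale_vec k \<alpha> + scale_vec l \<beta>" "y = scale_vec k' \<alpha> + scale_vec l' \<beta>" by blast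
    then show "x - y \<in> ?S"
      using S(2) by (intro CollectI exI [of _ "k - k'"] exI [of _ "l - l'"]) simp
  qed
  then obtain k l where k: "k \<in> S" "scale_vec 1 \<alpha> + scale_vec 0 \<beta> = scale_vec k \<alpha> + scale_vec l \<beta>"
    by auto
  then show ?thesis using wedge_independent(1) [OF assms(2) k(2)] by simp
qed

lemma primitive_vector:
  assumes "u \<noteq> 0"
  obtains \<alpha> d where "u = scale_vec d \<alpha>" "\<And>x. wedge u x = 0 \<Longrightarrow> \<exists>k. x = scale_vec k \<alpha>"
proof -
  let ?d = "gcd (fst u) (snd u)"
  let ?a = "fst u div ?d" let ?b = "snd u div ?d"
  have d: "?d \<noteq> 0" using assms by (auto simp: prod_eq_iff)
  have u: "u = scale_vec ?d (?a, ?b)" by (auto simp: scale_vec_def prod_eq_iff)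
  have "coprime ?a ?b" using assms by (intro div_gcd_coprime) (auto simp: prod_eq_iff)
  then obtain s t where st: "s * ?a + t * ?b = 1" using bezout_int [of ?a ?b] by auto
  have "\<exists>k. x = scale_vec k (?a, ?b)" if "wedge u x = 0" for x
  proof
    have "?d * (?a * snd x) = ?d * (?b * fst x)" using that by (simp add: wedge_def flip: mult.assoc)
    then have eq: "?a * snd x = ?b * fst x" using mult_left_cancel [OF d] by blast
    let ?k = "s * fst x + t * snd x"
    have "?k * ?a = (s * ?a + t * ?b) * fst x" using eq by (simp add: algebra_simps)
    moreover have "?k * ?b = (s * ?a + t * ?b) * snd x" using eq by (simp add: algebra_simps)
    ultimately show "x = scale_vec ?k (?a, ?b)" by (simp add: scale_vec_def st prod_eq_iff)
  qed
  with u show ?thesis by (intro that [of ?d "(?a, ?b)"]) auto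
qed

text \<open>The difference \<open>g x - g (x - v)\<close> is \<open>w\<close>-periodic. Where it is not \<open>0\<close> it is \<open>1\<close> or \<open>-1\<close>, and
  then it determines both of its terms, so that these are constant along progressions of
  difference \<open>w\<close>.\<close>

lemma mixed_difference_zero_column:
  assumes vals: "\<And>x. g x \<in> {0, 1::int}"
    and mixed: "act ((1 - X v) * (1 - X w)) g = (\<lambda>x. 0)"
    and "g (x - v) \<noteq> g x"
  obtains z \<sigma> where "\<And>k. g (z - scale_vec k w) = 1" "\<And>k. g (z + scale_vec \<sigma> v - scale_vec k w) = 0"
proof -
  define e where "e x = g x - g (x - v)" for x
  have e: "act (1 - X v) g = e" by (simp add: e_def act_diff fun_eq_iff)
  have "act (1 - X w) e = (\<lambda>x. 0)"
    using mixed by (simp only: mult.commute [of "1 - X v"] act_mult e)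
  then have "e (x - scale_vec k w) = e x" for k
    by (intro period_scale) (simp only: act_period_eq_0_iff)
  then have *: "g (x - scale_vec k w) - g (x - v - scale_vec k w) = g x - g (x - v)" for k
    by (simp add: e_def algebra_simps)
  have 01: "g y = 0 \<or> g y = 1" for y using vals by blast
  show ?thesis
  proof (cases "g x = 1")
    case True
    then have "g (x - v) = 0" using 01 [of "x - v"] assms(3) by auto
    then have "g (x - scale_vec k w) = 1 \<and> g (x - v - scale_vec k w) = 0" for k
      using * [of k] True 01 [of "x - scale_vec k w"] 01 [of "x - v - scale_vec k w"] by auto
    then show ?thesis by (intro that [of x "-1"]) auto
  next
    case False
    then have "g x = 0" "g (x - v) = 1" using 01 [of x] 01 [of "x - v"] assms(3) by auto
    then have "g (x - scale_vec k w) = 0 \<and> g (x - v - scale_vec k w) = 1" for k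
      using * [of k] 01 [of "x - scale_vec k w"] 01 [of "x - v - scale_vec k w"] by auto
    then show ?thesis by (intro that [of "x - v" 1]) auto
  qed
qed

text \<open>Were \<open>g\<close> periodic in neither direction, it would contain a full progression of difference
  \<open>p \<beta>\<close> next to an empty one, and a full progression of difference \<open>p \<alpha>\<close>. As the coordinates of
  the tile form complete residue systems, some two points of the progressions differ by an
  element of the tile. Uniqueness of the representation by the tile makes these two points equal,
  so the progressions meet; but then the second one also meets the empty progression.\<close>

lemma crossing_progressions_periodic:
  assumes vals: "\<And>x. g x \<in> {0, 1::int}"
    and mixed: "act ((1 - X (scale_vec (int p) \<alpha>)) * (1 - X (scale_vec (int p) \<beta>))) g = (\<lambda>x. 0)"
    and span: "\<And>x. \<exists>i j. x = scale_vec i \<alpha> + scale_vec j \<beta>"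
    and "finite F" "0 \<in> F" and tile: "\<And>x. (\<Sum>f\<in>F. g (x - f)) = 1"
    and F: "\<And>i j. i \<in> I \<Longrightarrow> j \<in> J \<Longrightarrow> scale_vec i \<alpha> + scale_vec j \<beta> \<in> F"
    and I: "(\<lambda>i. i mod int p) ` I = {0..<int p}" and J: "(\<lambda>i. i mod int p) ` J = {0..<int p}"
    and "p > 0"
  shows "(\<forall>x. g (x - scale_vec (int p) \<alpha>) = g x) \<or> (\<forall>x. g (x - scale_vec (int p) \<beta>) = g x)"
proof (rule ccontr)
  let ?v = "scale_vec (int p) \<alpha>" and ?w = "scale_vec (int p) \<beta>"
  assume "\<not> ?thesis"
  then obtain x y where xy: "g (x - ?v) \<noteq> g x" "g (y - ?w) \<noteq> g y" by blast
  obtain z \<sigma> where z: "\<And>k. g (z - scale_vec k ?w) = 1" "\<And>k. g (z + scale_vec \<sigma> ?v - scale_vec k ?w) = 0"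
    using mixed_difference_zero_column [OF vals mixed xy(1)] by blast
  have mixed': "act ((1 - X ?w) * (1 - X ?v)) g = (\<lambda>x. 0)"
    using mixed by (simp only: mult.commute)
  obtain z' where z': "\<And>k. g (z' - scale_vec k ?v) = 1"
    using mixed_difference_zero_column [OF vals mixed' xy(2)] by blast
  obtain i j where ij: "z - z' = scale_vec i \<alpha> + scale_vec j \<beta>" using span by blast
  have "i mod int p \<in> {0..<int p}" "j mod int p \<in> {0..<int p}" using assms(10) by auto
  then obtain i' j' where i': "i' \<in> I" "i mod int p = i' mod int p" and j': "j' \<in> J" "j mod int p = j' mod int p"
    using I J by (metis (no_types, lifting) imageE)
  obtain k l where kl: "i = i' + l * int p" "j = j' + k * int p"
    using i'(2) j'(2) by (metis mod_eq_dvd_iff dvdE mult.commute add.commute diff_add_cancel)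
  define f where "f = scale_vec i' \<alpha> + scale_vec j' \<beta>"
  define q where "q = z - scale_vec k ?w"
  have f: "f \<in> F" unfolding f_def by (rule F [OF i'(1) j'(1)])
  have "z = z' + (scale_vec i \<alpha> + scale_vec j \<beta>)" using ij by (simp add: algebra_simps)
  then have q: "q - f = z' + scale_vec l ?v"
    by (simp add: q_def f_def kl algebra_simps)
  have "f = 0"
  proof (rule ccontr)
    assume "f \<noteq> 0"
    have "g (q - f) = 1" using z' [of "- l"] by (simp add: q)
    moreover have "g q = 1" using z(1) [of k] by (simp add: q_def)
    moreover have "(\<Sum>a\<in>{0, f}. g (q - a)) \<le> (\<Sum>a\<in>F. g (q - a))"
    proof (rule sum_mono2 [OF assms(4)])
      show "0 \<le> g (q - b)" for b using vals [of "q - b"] by auto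
    qed (use f assms(5) in auto)
    ultimately show False using tile [of q] \<open>f \<noteq> 0\<close> by simp
  qed
  then have "q = z' + scale_vec l ?v" using q by simp
  then have "z + scale_vec \<sigma> ?v - scale_vec k ?w = z' - scale_vec (- l - \<sigma>) ?v"
    by (simp add: q_def algebra_simps)
  then show False using z(2) [of k] z' [of "- l - \<sigma>"] by simp
qed

lemma period_group:
  "0 \<in> {k. \<forall>x. h (x - scale_vec k w) = h x}"
  "k \<in> {k. \<forall>x. h (x - scale_vec k w) = h x} \<Longrightarrow> l \<in> {k. \<forall>x. h (x - scale_vec k w) = h x}
    \<Longrightarrow> k - l \<in> {k. \<forall>x. h (x - scale_vec k w) = h x}"
proof -
  assume k: "k \<in> {k. \<forall>x. h (x - scale_vec k w) = h x}" and l: "l \<in> {k. \<forall>x. h (x - scale_vec k w) = h x}"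
  have "h (x - scale_vec (k - l) w) = h x" for x
  proof -
    have "h (x - scale_vec (k - l) w) = h (x + scale_vec l w - scale_vec k w)" by (simp add: algebra_simps)
    also have "\<dots> = h (x + scale_vec l w)" using k by blast
    also have "\<dots> = h (x + scale_vec l w - scale_vec l w)"
      using spec [OF CollectD [OF l], of "x + scale_vec l w"] by (rule sym)
    finally show ?thesis by simp
  qed
  then show "k - l \<in> {k. \<forall>x. h (x - scale_vec k w) = h x}" by blast
qed simp

lemma prime_tile_period_line:
  fixes h :: "vec \<Rightarrow> int"
  assumes "prime p" "finite I" "card I = p" "0 \<in> I" "e \<noteq> 0" "\<And>x. h x \<ge> 0"
    and "\<And>x. (\<Sum>i\<in>I. h (x - scale_vec i e)) = 1" "i \<in> I"
  shows "h (x - scale_vec (int p) (scale_vec i e)) = h x"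
proof -
  let ?A = "(\<lambda>i. scale_vec i e) ` I"
  have inj: "inj_on (\<lambda>i. scale_vec i e) I" using assms(5) by (auto simp: inj_on_def scale_vec_cancel)
  have "act (mask_poly ?A 1) h = (\<lambda>x. 1)"
    by (simp add: fun_eq_iff act_mask sum.reindex [OF inj] assms(7))
  moreover have "0 \<in> ?A" using assms(4) by (auto intro!: image_eqI [of _ _ 0])
  ultimately have "h (x - scale_vec (int p) (scale_vec i e)) = h (x - scale_vec (int p) 0)"
    using assms by (intro prime_tile_period [of p ?A]) (auto simp: card_image [OF inj])
  then show ?thesis by simp
qed

text \<open>Convolving \<open>g\<close> with one factor of the product tile leaves a tiling by the other factor, of
  prime size. Its period is \<open>p\<close> times the primitive vector of the factor that remains, because
  the tile spans the lattice. So \<open>I\<close> represents all residues modulo \<open>p\<close> and can be replaced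
  by \<open>0, \<dots>, p - 1\<close>, whose generating polynomial \<open>c\<close> becomes the difference
  \<open>1 - X (scale_vec p \<alpha>)\<close> when multiplied by \<open>1 - X \<alpha>\<close>. The period of \<open>act c g\<close> in the other
  direction then says that the mixed difference of \<open>g\<close> vanishes.\<close>

lemma product_tiling_periodic:
  assumes "prime p" and fin: "finite I" "finite J" and card: "card I = p" "card J = p"
    and zero: "0 \<in> I" "0 \<in> J" and ind: "wedge \<alpha> \<beta> \<noteq> 0"
    and F: "bij_betw (\<lambda>(i, j). scale_vec i \<alpha> + scale_vec j \<beta>) (I \<times> J) F"
    and span: "group_closure {a - b |a b. a \<in> F \<and> b \<in> F} = UNIV"
    and vals: "\<And>x. g x \<in> {0, 1::int}" and tile: "\<And>x. (\<Sum>f\<in>F. g (x - f)) = 1"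
  shows "(\<forall>x. g (x - scale_vec (int p) \<alpha>) = g x) \<or> (\<forall>x. g (x - scale_vec (int p) \<beta>) = g x)"
proof -
  have p: "p > 0" using assms(1) by (rule prime_gt_0_nat)
  have \<alpha>\<beta>: "\<alpha> \<noteq> 0" "\<beta> \<noteq> 0" using ind by (auto simp: wedge_def)
  have F_mem: "scale_vec i \<alpha> + scale_vec j \<beta> \<in> F" if "i \<in> I" "j \<in> J" for i j
    using F that by (auto simp: bij_betw_def)
  have F_D: "\<exists>i\<in>I. \<exists>j\<in>J. f = scale_vec i \<alpha> + scale_vec j \<beta>" if "f \<in> F" for f
    using F that by (auto simp: bij_betw_def)
  have g0: "g x \<ge> 0" for x using vals [of x] by auto
  define a where "a = (\<Sum>i\<in>I. X (scale_vec i \<alpha>))"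
  define b where "b = (\<Sum>j\<in>J. X (scale_vec j \<beta>))"
  have act_a: "act a h x = (\<Sum>i\<in>I. h (x - scale_vec i \<alpha>))" for h x by (simp add: a_def act_sum)
  have act_b: "act b h x = (\<Sum>j\<in>J. h (x - scale_vec j \<beta>))" for h x by (simp add: b_def act_sum)
  have "act a (act b g) x = (\<Sum>(i, j)\<in>I \<times> J. g (x - (scale_vec i \<alpha> + scale_vec j \<beta>)))" for x
    by (simp add: act_a act_b sum.cartesian_product diff_diff_eq)
  also have "(\<Sum>(i, j)\<in>I \<times> J. g (x - (scale_vec i \<alpha> + scale_vec j \<beta>))) = (\<Sum>f\<in>F. g (x - f))" for x
    using sum.reindex_bij_betw [OF F, of "\<lambda>f. g (x - f)"] by (simp add: case_prod_unfold)
  finally have ab: "act a (act b g) = (\<lambda>x. 1)" by (simp add: tile fun_eq_iff)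
  have periodic_\<alpha>: "h (x - scale_vec (int p) \<alpha>) = h x"
    if "\<And>x. h x \<ge> 0" "act a h = (\<lambda>x. 1)" for h x
  proof -
    have tile: "(\<Sum>i\<in>I. h (x - scale_vec i \<alpha>)) = 1" for x
      using that(2) by (simp add: fun_eq_iff act_a)
    let ?S = "{k. \<forall>x. h (x - scale_vec k (scale_vec (int p) \<alpha>)) = h x}"
    have "1 \<in> ?S"
    proof (rule one_in_coordinate_group [OF span ind])
      fix f assume "f \<in> F"
      then obtain i j where ij: "i \<in> I" "f = scale_vec i \<alpha> + scale_vec j \<beta>" using F_D by blast
      have "\<forall>x. h (x - scale_vec i (scale_vec (int p) \<alpha>)) = h x"
      proof
        fix x
        show "h (x - scale_vec i (scale_vec (int p) \<alpha>)) = h x"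
          using prime_tile_period_line [OF assms(1) fin(1) card(1) zero(1) \<alpha>\<beta>(1) that(1) tile ij(1), of x]
          by (simp add: mult.commute)
      qed
      with ij show "\<exists>k\<in>?S. \<exists>l. f = scale_vec k \<alpha> + scale_vec l \<beta>" by blast
    next
      show "0 \<in> ?S" by (rule period_group(1))
      show "k - l \<in> ?S" if "k \<in> ?S" "l \<in> ?S" for k l using that by (rule period_group(2))
    qed
    then show ?thesis by simp
  qed
  have ind': "wedge \<beta> \<alpha> \<noteq> 0" using ind by (simp add: wedge_swap [of \<beta> \<alpha>])
  have periodic_\<beta>: "h (x - scale_vec (int p) \<beta>) = h x"
    if "\<And>x. h x \<ge> 0" "act b h = (\<lambda>x. 1)" for h x
  proof -
    have tile: "(\<Sum>j\<in>J. h (x - scale_vec j \<beta>)) = 1" for x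
      using that(2) by (simp add: fun_eq_iff act_b)
    let ?S = "{k. \<forall>x. h (x - scale_vec k (scale_vec (int p) \<beta>)) = h x}"
    have "1 \<in> ?S"
    proof (rule one_in_coordinate_group [OF span ind'])
      fix f assume "f \<in> F"
      then obtain i j where ij: "j \<in> J" "f = scale_vec j \<beta> + scale_vec i \<alpha>"
        using F_D by (metis add.commute)
      have "\<forall>x. h (x - scale_vec j (scale_vec (int p) \<beta>)) = h x"
      proof
        fix x
        show "h (x - scale_vec j (scale_vec (int p) \<beta>)) = h x"
          using prime_tile_period_line [OF assms(1) fin(2) card(2) zero(2) \<alpha>\<beta>(2) that(1) tile ij(1), of x]
          by (simp add: mult.commute)
      qed
      with ij show "\<exists>k\<in>?S. \<exists>l. f = scale_vec k \<beta> + scale_vec l \<alpha>" by blast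
    next
      show "0 \<in> ?S" by (rule period_group(1))
      show "k - l \<in> ?S" if "k \<in> ?S" "l \<in> ?S" for k l using that by (rule period_group(2))
    qed
    then show ?thesis by simp
  qed
  have nn_b: "act b g x \<ge> 0" for x by (auto simp: act_b intro!: sum_nonneg g0)
  have per_b: "act b g (x - scale_vec (int p) \<alpha>) = act b g x" for x
    by (rule periodic_\<alpha> [OF nn_b ab])
  have tile_b: "(\<Sum>i\<in>I. act b g (x - scale_vec i \<alpha>)) = 1" for x
    using ab by (simp add: fun_eq_iff act_a)
  have bij_I: "bij_betw (\<lambda>i. i mod int p) I {0..<int p}"
    by (rule tile_complete_residues [where h = "act b g", OF fin(1) card(1) p nn_b per_b tile_b])
  \<comment> \<open>the interval that replaces the first factor of the tile\<close>
  define c where "c = (\<Sum>i<p. X \<alpha> ^ i)"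
  have act_c: "act c h x = (\<Sum>i<p. h (x - scale_vec (int i) \<alpha>))" for h x
    by (simp add: c_def act_sum X_power)
  have "act c (act b g) = (\<lambda>x. 1)"
    by (simp add: fun_eq_iff act_c sum_over_residues [where h = "act b g", OF bij_I per_b] tile_b)
  then have bc: "act b (act c g) = (\<lambda>x. 1)" by (simp only: act_commute)
  have nn_c: "act c g x \<ge> 0" for x by (auto simp: act_c intro!: sum_nonneg g0)
  have per_c: "act c g (x - scale_vec (int p) \<beta>) = act c g x" for x
    by (rule periodic_\<beta> [OF nn_c bc])
  have bij_J: "bij_betw (\<lambda>j. j mod int p) J {0..<int p}"
    by (rule tile_complete_residues [where h = "act c g", OF fin(2) card(2) p nn_c per_c]) (use bc in \<open>simp add: fun_eq_iff act_b\<close>)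
  have "(1 - X (scale_vec (int p) \<alpha>)) * (1 - X (scale_vec (int p) \<beta>)) = (1 - X \<alpha>) * ((1 - X (scale_vec (int p) \<beta>)) * c)"
    unfolding c_def X_power [of \<alpha> p, symmetric] one_diff_power_eq by (simp only: mult_ac)
  moreover have "act (1 - X (scale_vec (int p) \<beta>)) (act c g) = (\<lambda>x. 0)"
    unfolding act_period_eq_0_iff using per_c by blast
  ultimately have mixed: "act ((1 - X (scale_vec (int p) \<alpha>)) * (1 - X (scale_vec (int p) \<beta>))) g = (\<lambda>x. 0)"
    by (simp only: act_mult act_zero_right)
  have coordinates: "\<exists>i j. x = scale_vec i \<alpha> + scale_vec j \<beta>" for x
  proof -
    let ?S = "{scale_vec i \<alpha> + scale_vec j \<beta> |i j. True}"
    have "x \<in> ?S"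
    proof (rule spanning_set_closed_under_diff [OF span])
      show "F \<subseteq> ?S" using F_D by blast
      show "0 \<in> ?S" by (auto intro!: exI [of _ 0])
      fix x y assume "x \<in> ?S" "y \<in> ?S"
      then obtain i j i' j' where
        "x = scale_vec i \<alpha> + scale_vec j \<beta>" "y = scale_vec i' \<alpha> + scale_vec j' \<beta>" by blast
      then show "x - y \<in> ?S" by (intro CollectI exI [of _ "i - i'"] exI [of _ "j - j'"]) simp
    qed
    then show ?thesis by blast
  qed
  have "finite F" using F fin by (metis bij_betw_finite finite_cartesian_product)
  moreover have "0 \<in> F" using F_mem [OF zero] by simp
  ultimately show ?thesis
    using bij_I bij_J F_mem
    by (intro crossing_progressions_periodic [OF vals mixed coordinates _ _ tile, of I J])
      (auto simp: bij_betw_def p)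
qed

lemma two_divisible_directions_imp_periodic:
  assumes "prime p" "finite F" "0 \<in> F" "card F = p\<^sup>2" "wedge u v \<noteq> 0"
    and "divisible_line_counts p F u" "divisible_line_counts p F v"
    and span: "group_closure {a - b |a b. a \<in> F \<and> b \<in> F} = UNIV"
    and vals: "\<And>x. g x \<in> {0, 1::int}" and tile: "\<And>x. (\<Sum>f\<in>F. g (x - f)) = 1"
  shows "\<exists>w. w \<noteq> 0 \<and> (\<forall>x. g (x - w) = g x)"
proof -
  define A where "A = {a \<in> F. wedge u a = 0}"
  define B where "B = {b \<in> F. wedge v b = 0}"
  have "u \<noteq> 0" "v \<noteq> 0" using assms(5) by (auto simp: wedge_def)
  have vu: "wedge v u \<noteq> 0" using assms(5) by (simp add: wedge_swap [of v u])
  obtain \<alpha> d where \<alpha>: "u = scale_vec d \<alpha>" "\<And>x. wedge u x = 0 \<Longrightarrow> \<exists>k. x = scale_vec k \<alpha>"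
    using primitive_vector [OF \<open>u \<noteq> 0\<close>] by metis
  obtain \<beta> d' where \<beta>: "v = scale_vec d' \<beta>" "\<And>x. wedge v x = 0 \<Longrightarrow> \<exists>k. x = scale_vec k \<beta>"
    using primitive_vector [OF \<open>v \<noteq> 0\<close>] by metis
  have ind: "wedge \<alpha> \<beta> \<noteq> 0"
  proof
    assume "wedge \<alpha> \<beta> = 0"
    then have "wedge \<alpha> v = 0" by (simp add: \<beta>(1))
    then have "wedge v u = 0" by (simp add: \<alpha>(1) wedge_swap [of v])
    with vu show False by simp
  qed
  have nz: "\<alpha> \<noteq> 0" "\<beta> \<noteq> 0" using ind by (auto simp: wedge_def)
  define I where "I = {i. scale_vec i \<alpha> \<in> A}"
  define J where "J = {j. scale_vec j \<beta> \<in> B}"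
  have A: "bij_betw (\<lambda>i. scale_vec i \<alpha>) I A"
  proof (rule bij_betwI')
    show "\<exists>i\<in>I. x = scale_vec i \<alpha>" if "x \<in> A" for x
      using that \<alpha>(2) [of x] by (auto simp: I_def A_def)
  qed (use nz in \<open>auto simp: I_def scale_vec_cancel\<close>)
  have B: "bij_betw (\<lambda>j. scale_vec j \<beta>) J B"
  proof (rule bij_betwI')
    show "\<exists>j\<in>J. x = scale_vec j \<beta>" if "x \<in> B" for x
      using that \<beta>(2) [of x] by (auto simp: J_def B_def)
  qed (use nz in \<open>auto simp: J_def scale_vec_cancel\<close>)
  have fin: "finite A" "finite B" using assms(2) by (auto simp: A_def B_def)
  have "bij_betw (\<lambda>(a, b). a + b) (A \<times> B) F"
    unfolding A_def B_def by (rule product_of_axes [OF assms(1-7)])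
  then have "bij_betw ((\<lambda>(a, b). a + b) \<circ> map_prod (\<lambda>i. scale_vec i \<alpha>) (\<lambda>j. scale_vec j \<beta>)) (I \<times> J) F"
    by (rule bij_betw_trans [OF bij_betw_map_prod [OF A B]])
  moreover have "(\<lambda>(a, b). a + b) \<circ> map_prod (\<lambda>i. scale_vec i \<alpha>) (\<lambda>j. scale_vec j \<beta>)
      = (\<lambda>(i, j). scale_vec i \<alpha> + scale_vec j \<beta>)" by auto
  ultimately have F: "bij_betw (\<lambda>(i, j). scale_vec i \<alpha> + scale_vec j \<beta>) (I \<times> J) F" by simp
  have "card A = p" "card B = p"
    unfolding A_def B_def
    using axis_of_divisible_directions(1) [OF assms(1-4) vu assms(7,6)]
      axis_of_divisible_directions(1) [OF assms(1-7)] by auto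
  then have card: "card I = p" "card J = p"
    using bij_betw_same_card [OF A] bij_betw_same_card [OF B] by auto
  have zero: "0 \<in> I" "0 \<in> J" using assms(3) by (auto simp: I_def J_def A_def B_def)
  have "(\<forall>x. g (x - scale_vec (int p) \<alpha>) = g x) \<or> (\<forall>x. g (x - scale_vec (int p) \<beta>) = g x)"
    using A B fin card zero by (intro product_tiling_periodic [OF assms(1) _ _ card zero ind F span vals tile])
      (auto simp: bij_betw_finite)
  moreover have "scale_vec (int p) \<alpha> \<noteq> 0" "scale_vec (int p) \<beta> \<noteq> 0"
    using nz prime_gt_0_nat [OF assms(1)] by (auto simp: scale_vec_eq_0_iff)
  ultimately show ?thesis by blast
qed

section \<open>Tilings by clusters of prime-squared size\<close>

lemma tiling_sum_indicator:
  assumes "tiling F T" "finite F"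
  shows "(\<Sum>f\<in>F. indicator T (x - f)) = (1::int)"
proof -
  let ?Q = "\<lambda>z. fst z \<in> F \<and> snd z \<in> T \<and> fst z + snd z = x"
  have ex1: "\<exists>!z. ?Q z" using assms(1) by (simp add: tiling_def case_prod_unfold)
  then obtain z where z: "?Q z" by blast
  have uniq: "y = z" if "?Q y" for y by (rule Uniq_D [OF ex1_iff_ex_Uniq [THEN iffD1, THEN conjunct2, OF ex1] that z])
  have "(\<Sum>f\<in>F. indicator T (x - f)) = (\<Sum>f\<in>F. if f = fst z then 1 else (0::int))"
  proof (rule sum.cong [OF refl])
    fix f assume f: "f \<in> F"
    have "x - f \<in> T \<longleftrightarrow> f = fst z"
    proof
      assume "x - f \<in> T"
      then show "f = fst z" using uniq [of "(f, x - f)"] f by auto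
    next
      assume "f = fst z"
      moreover have "x - fst z = snd z" using z by (simp add: diff_eq_eq add.commute)
      ultimately show "x - f \<in> T" using z by simp
    qed
    then show "indicator T (x - f) = (if f = fst z then 1 else (0::int))" by (simp add: indicator_def)
  qed
  also have "\<dots> = 1" using z assms(2) by simp
  finally show ?thesis .
qed

lemma tiling_one_periodic:
  assumes "prime p" "finite F" "full_affine_span F" "card F = p\<^sup>2" "tiling F T"
  shows "one_periodic T"
proof -
  define g where "g = (indicator T :: vec \<Rightarrow> int)"
  have vals: "g x \<in> {0, 1}" for x by (simp add: g_def indicator_def)
  have p: "p \<ge> 2" using assms(1) by (rule prime_ge_2_nat)
  then have "card F \<noteq> 0" by (simp add: assms(4))
  then obtain a0 where a0: "a0 \<in> F" by fastforce
  \<comment> \<open>a translate that contains the origin, as the annihilating product needs a distinguished point\<close>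
  define F0 where "F0 = (\<lambda>a. a - a0) ` F"
  have inj: "inj_on (\<lambda>a. a - a0) F" by (simp add: inj_on_def)
  have F0: "finite F0" "0 \<in> F0" "card F0 = p\<^sup>2"
    using a0 assms(2,4) card_image [OF inj] by (auto simp: F0_def)
  have "{a - b |a b. a \<in> F0 \<and> b \<in> F0} = {a - b |a b. a \<in> F \<and> b \<in> F}"
  proof (intro equalityI subsetI)
    fix x assume "x \<in> {a - b |a b. a \<in> F0 \<and> b \<in> F0}"
    then obtain a b where "x = (a - a0) - (b - a0)" "a \<in> F" "b \<in> F" unfolding F0_def by blast
    then have "x = a - b" "a \<in> F" "b \<in> F" by simp_all
    then show "x \<in> {a - b |a b. a \<in> F \<and> b \<in> F}" by blast
  next
    fix x assume "x \<in> {a - b |a b. a \<in> F \<and> b \<in> F}"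
    then obtain a b where "x = (a - a0) - (b - a0)" "a \<in> F" "b \<in> F" by auto
    then show "x \<in> {a - b |a b. a \<in> F0 \<and> b \<in> F0}" unfolding F0_def by blast
  qed
  then have span: "group_closure {a - b |a b. a \<in> F0 \<and> b \<in> F0} = UNIV"
    using assms(3) by (simp add: full_affine_span_def)
  have tile: "(\<Sum>f\<in>F0. g (x - f)) = 1" for x
  proof -
    have "(\<Sum>f\<in>F0. g (x - f)) = (\<Sum>f\<in>F. g (x + a0 - f))"
      unfolding F0_def by (subst sum.reindex [OF inj]) (simp add: algebra_simps)
    also have "\<dots> = 1" unfolding g_def by (rule tiling_sum_indicator [OF assms(5,2)])
    finally show ?thesis .
  qed
  have dil: "act (mask_poly F0 r) g = (\<lambda>x. 1)" if "r > 0" "coprime r p" for r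
  proof (rule dilated_tiling)
    show "g x \<ge> 0" for x using vals [of x] by auto
    show "act (mask_poly F0 1) g = (\<lambda>x. 1)" by (simp add: fun_eq_iff act_mask tile)
    show "coprime r (card F0)" using that(2) by (simp add: F0)
  qed (use F0 that in auto)
  have ne: "F0 \<noteq> {0}"
  proof
    assume "F0 = {0}"
    then have "p\<^sup>2 = 1" using F0(3) by simp
    then show False using p by simp
  qed
  have "act (\<Prod>a\<in>F0 - {0}. 1 - X a ^ p) g = (\<lambda>x. 0)"
  proof (rule product_of_differences_annihilates [OF F0(1,2) ne])
    fix j
    show "act (mask_poly F0 (1 + p * j)) g = (\<lambda>x. 1)"
    proof (rule dil)
      show "coprime (1 + p * j) p"
      proof (rule coprimeI)
        fix c assume "c dvd 1 + p * j" "c dvd p"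
        then show "is_unit c" by (metis dvd_add_left_iff dvd_mult2)
      qed
    qed simp
  qed
  also have "(\<Prod>a\<in>F0 - {0}. 1 - X a ^ p) = (\<Prod>a\<in>scale_vec (int p) ` (F0 - {0}). 1 - X a)"
  proof -
    have "inj_on (scale_vec (int p)) (F0 - {0})"
      using p scale_vec_eq_0_iff [of "int p" "_ - _"] by (auto simp: inj_on_def scale_vec_diff)
    then show ?thesis by (simp add: prod.reindex X_power)
  qed
  finally have ann: "act (\<Prod>a\<in>scale_vec (int p) ` (F0 - {0}). 1 - X a) g = (\<lambda>x. 0)" .
  define P where "P = scale_vec (int p) ` (F0 - {0})"
  have P: "finite P" "0 \<notin> P" using F0(1) p by (auto simp: P_def scale_vec_eq_0_iff)
  have "F0 - {0} \<noteq> {}" using ne F0(2) by blast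
  then obtain u where u: "u \<in> P" unfolding P_def by blast
  have "bounded_config g" unfolding bounded_config_def using vals
    by (intro exI [of _ 1]) (auto simp: g_def indicator_def)
  then have "(\<exists>w. w \<noteq> 0 \<and> (\<forall>x. g (x - w) = g x)) \<or>
    (\<exists>u v. wedge u v \<noteq> 0 \<and> divisible_line_counts p F0 u \<and> divisible_line_counts p F0 v)"
  proof (rule periodic_or_two_divisible_directions [OF assms(1) F0(1) _ dil])
    show "act ((1 - X u) * (\<Prod>a\<in>P - {u}. 1 - X a)) g = (\<lambda>x. 0)"
      using ann prod.remove [OF P(1) u, of "\<lambda>a. 1 - X a"] by (simp add: P_def)
  qed (use P u in auto)
  then have "\<exists>w. w \<noteq> 0 \<and> (\<forall>x. g (x - w) = g x)"
    using two_divisible_directions_imp_periodic [OF assms(1) F0 _ _ _ span vals tile] by blast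
  then obtain w where w: "w \<noteq> 0" "\<And>x. g (x - w) = g x" by blast
  have iff: "x - w \<in> T \<longleftrightarrow> x \<in> T" for x
    using w(2) [of x] by (auto simp: g_def indicator_def split: if_splits)
  have "(\<lambda>t. t + w) ` T = T"
  proof (intro equalityI subsetI)
    fix x assume "x \<in> T"
    then have "x - w \<in> T" by (simp add: iff)
    then show "x \<in> (\<lambda>t. t + w) ` T" by (rule rev_image_eqI) simp
  next
    fix x assume "x \<in> (\<lambda>t. t + w) ` T"
    then show "x \<in> T" using iff [of x] by auto
  qed
  with w(1) show ?thesis unfolding one_periodic_def by blast
qed

lemma indicator_in_orbit_closure: "indicator T \<in> orbit_closure T"
proof -
  have "range (\<lambda>v. shift v (indicator T)) \<subseteq> topspace config_space"
    by (auto simp: config_space_def shift_def indicator_def)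
  moreover have "indicator T = shift 0 (indicator T)" by (simp add: shift_def)
  ultimately show ?thesis
    unfolding orbit_closure_def using closure_of_subset by blast
qed

theorem theorem1p2:
  fixes p :: nat and F T :: "(int \<times> int) set"
  assumes "prime p"
    and "finite F"
    and "exact F"
    and "full_affine_span F"
    and "card F = p ^ 2"
    and "tiling F T"
  shows "\<exists>T'. indicator T' \<in> orbit_closure T \<and> tiling F T' \<and> one_periodic T'"
  using indicator_in_orbit_closure assms(6) tiling_one_periodic [OF assms(1,2,4-6)] by blast

end
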